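(* Let $\mathcal{M}_x,\mathcal{M}_y$ be Riemannian manifolds and let $f,g:\mathcal{M}_x\times\mathcal{M}_y\to\mathbb{R}$ be jointly smooth real-valued functions such that, for every $x\in\mathcal{M}_x$, the function $g(x,\cdot)$ is geodesic strongly convex in $y$, with unique minimizer $y^*(x)=\arg\min_{y\in\mathcal{M}_y} g(x,y)$. Let $F(x):=f(x,y^*(x))$. Then the differential of $y^*$ at $x$ and the Riemannian gradient (hypergradient) of $F$ at $x$ are given by $$\mathrm{D}y^*(x)=-\mathcal{H}_y^{-1}g(x,y^*(x))\circ\mathcal{G}^2_{yx}g(x,y^*(x)),$$ $$\mathcal{G}F(x)=\mathcal{G}_xf(x,y^*(x))-\mathcal{G}^2_{xy}g(x,y^*(x))\big[\mathcal{H}_y^{-1}g(x,y^*(x))[\mathcal{G}_yf(x,y^*(x))]\big].$$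
   Context: For $\phi:\mathcal{M}_x\times\mathcal{M}_y\to\mathbb{R}$, $\mathcal{G}_x\phi(x,y)\in T_x\mathcal{M}_x$ and $\mathcal{G}_y\phi(x,y)\in T_y\mathcal{M}_y$ denote the Riemannian partial gradients, and $\mathcal{H}_y\phi(x,y):T_y\mathcal{M}_y\to T_y\mathcal{M}_y$ the Riemannian Hessian in $y$ (covariant derivative of the Riemannian gradient of $\phi(x,\cdot)$); $\mathcal{H}_y^{-1}\phi(x,y)$ is its inverse operator. The Riemannian cross derivatives are the linear operators $\mathcal{G}^2_{xy}\phi(x,y):T_y\mathcal{M}_y\to T_x\mathcal{M}_x$, $\mathcal{G}^2_{xy}\phi(x,y)[v]=\mathrm{D}_y\mathcal{G}_x\phi(x,y)[v]$, and $\mathcal{G}^2_{yx}\phi(x,y):T_x\mathcal{M}_x\to T_y\mathcal{M}_y$, $\mathcal{G}^2_{yx}\phi(x,y)[u]=\mathrm{D}_x\mathcal{G}_y\phi(x,y)[u]$, where $\mathrm{D}$ is the differential. A smooth function $h$ on a manifold is $\mu$-geodesic strongly convex ($\mu>0$) if its restriction to geodesics satisfies $h(\mathrm{Exp}_z(tu))\ge h(z)+t\langle\mathcal{G}h(z),u\rangle_z+t^2\frac{\mu}{2}\|u\|_z^2$ for $t\in[0,1]$; equivalently its Riemannian Hessian satisfies $\mathcal{H}h(z)\succeq\mu\,\mathrm{id}$.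
   Formalization: The formal theorem also assumes that any two points of M_y are joined by a geodesic (automatic if M_y is complete and connected); without such an assumption y* can jump and the claim fails. The manifolds have positive dimension. *)

theory Defs
  imports "HOL-Analysis.Analysis" "HOL-Library.Function_Algebras"
begin

text \<open>Function spaces are real vector spaces pointwise. Tangent vectors are represented below as
  functions from charts to coordinate vectors, and this is the vector space structure they use.\<close>

instantiation "fun" :: (type, real_vector) real_vector
begin

definition scaleR_fun_def: "r *\<^sub>R f = (\<lambda>x. r *\<^sub>R f x)"

instance
  by standard (simp_all add: fun_eq_iff scaleR_fun_def scaleR_add_right scaleR_add_left)

end


section \<open>Smooth manifolds\<close>

primrec Ck_on :: "nat \<Rightarrow> 'a::euclidean_space set \<Rightarrow> ('a \<Rightarrow> 'b::real_normed_vector) \<Rightarrow> bool" where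
  "Ck_on 0 S f \<longleftrightarrow> continuous_on S f"
| "Ck_on (Suc k) S f \<longleftrightarrow> (\<forall>x\<in>S. f differentiable (at x)) \<and>
     (\<forall>v. Ck_on k S (\<lambda>x. frechet_derivative f (at x) v))"

definition smooth_on :: "'a::euclidean_space set \<Rightarrow> ('a \<Rightarrow> 'b::real_normed_vector) \<Rightarrow> bool" where
  "smooth_on S f \<longleftrightarrow> (\<forall>k. Ck_on k S f)"

text \<open>A chart is a pair of its domain and its coordinate map; the values of the coordinate map
  outside the domain are irrelevant.\<close>

type_synonym ('a, 'e) chart = "'a set \<times> ('a \<Rightarrow> 'e)"

abbreviation chart_dom :: "('a, 'e) chart \<Rightarrow> 'a set" where
  "chart_dom c \<equiv> fst c"

abbreviation coord :: "('a, 'e) chart \<Rightarrow> 'a \<Rightarrow> 'e" where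
  "coord c \<equiv> snd c"

definition chart_inv :: "('a, 'e) chart \<Rightarrow> 'e \<Rightarrow> 'a" where
  "chart_inv c = inv_into (chart_dom c) (coord c)"

definition is_chart :: "('a::topological_space, 'e::euclidean_space) chart \<Rightarrow> bool" where
  "is_chart c \<longleftrightarrow> open (chart_dom c) \<and> open (coord c ` chart_dom c) \<and>
     homeomorphism (chart_dom c) (coord c ` chart_dom c) (coord c) (chart_inv c)"

definition transition :: "('a, 'e) chart \<Rightarrow> ('a, 'e) chart \<Rightarrow> 'e \<Rightarrow> 'e" where
  "transition c d = coord d \<circ> chart_inv c"

definition smooth_atlas :: "('a::topological_space, 'e::euclidean_space) chart set \<Rightarrow> bool" where
  "smooth_atlas A \<longleftrightarrow> (\<forall>c\<in>A. is_chart c) \<and> (\<Union>c\<in>A. chart_dom c) = UNIV \<and>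
     (\<forall>c\<in>A. \<forall>d\<in>A. smooth_on (coord c ` (chart_dom c \<inter> chart_dom d)) (transition c d))"

definition smooth_fun :: "('a, 'e::euclidean_space) chart set \<Rightarrow> ('a \<Rightarrow> real) \<Rightarrow> bool" where
  "smooth_fun A \<phi> \<longleftrightarrow> (\<forall>c\<in>A. smooth_on (coord c ` chart_dom c) (\<phi> \<circ> chart_inv c))"

text \<open>The atlas of a product manifold.\<close>

definition prod_atlas ::
  "('a, 'e) chart set \<Rightarrow> ('b, 'f) chart set \<Rightarrow> ('a \<times> 'b, 'e \<times> 'f) chart set" where
  "prod_atlas A B =
     {(chart_dom c \<times> chart_dom d, map_prod (coord c) (coord d)) | c d. c \<in> A \<and> d \<in> B}"


section \<open>Tangent vectors and Riemannian metrics\<close>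

text \<open>A tangent vector at a point \<open>p\<close> is the family of its coordinate vectors in all charts
  around \<open>p\<close>, related by the derivatives of the transition maps. Entries for charts not
  containing \<open>p\<close> are set to 0, so that equality of tangent vectors is equality of functions.\<close>

type_synonym ('a, 'e) tvec = "('a, 'e) chart \<Rightarrow> 'e"

text \<open>A Riemannian manifold lives on a whole type, whose topology is the manifold topology;
  its data are an atlas and an inner product on each tangent space.\<close>

record ('a, 'e) rmanifold =
  atlas :: "('a, 'e) chart set"
  rmetric :: "'a \<Rightarrow> ('a, 'e) tvec \<Rightarrow> ('a, 'e) tvec \<Rightarrow> real"

definition charts_at :: "('a, 'e) rmanifold \<Rightarrow> 'a \<Rightarrow> ('a, 'e) chart set" where
  "charts_at M p = {c \<in> atlas M. p \<in> chart_dom c}"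

definition tangent_space ::
  "('a, 'e::euclidean_space) rmanifold \<Rightarrow> 'a \<Rightarrow> ('a, 'e) tvec set" where
  "tangent_space M p = {v.
     (\<forall>c\<in>charts_at M p. \<forall>d\<in>charts_at M p.
        v d = frechet_derivative (transition c d) (at (coord c p)) (v c)) \<and>
     (\<forall>c. c \<notin> charts_at M p \<longrightarrow> v c = 0)}"

text \<open>The tangent vector at \<open>p\<close> whose coordinate vector in the chart \<open>c\<close> is \<open>a\<close>.\<close>

definition tangent_of ::
  "('a, 'e::euclidean_space) rmanifold \<Rightarrow> 'a \<Rightarrow> ('a, 'e) chart \<Rightarrow> 'e \<Rightarrow> ('a, 'e) tvec" where
  "tangent_of M p c a = (\<lambda>d. if d \<in> charts_at M p
     then frechet_derivative (transition c d) (at (coord c p)) a else 0)"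

text \<open>The metric in the chart \<open>c\<close>, at the coordinate point \<open>z\<close>.\<close>

definition metric_in_chart ::
  "('a, 'e::euclidean_space) rmanifold \<Rightarrow> ('a, 'e) chart \<Rightarrow> 'e \<Rightarrow> 'e \<Rightarrow> 'e \<Rightarrow> real" where
  "metric_in_chart M c z a b = rmetric M (chart_inv c z)
     (tangent_of M (chart_inv c z) c a) (tangent_of M (chart_inv c z) c b)"

definition riemannian_manifold ::
  "('a::{t2_space, second_countable_topology}, 'e::euclidean_space) rmanifold \<Rightarrow> bool" where
  "riemannian_manifold M \<longleftrightarrow>
     smooth_atlas (atlas M) \<and>
     (\<forall>p. \<forall>u\<in>tangent_space M p. \<forall>v\<in>tangent_space M p.
        rmetric M p u v = rmetric M p v u \<and>
        (\<forall>w\<in>tangent_space M p. rmetric M p (u + w) v = rmetric M p u v + rmetric M p w v) \<and>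
        (\<forall>r. rmetric M p (r *\<^sub>R u) v = r * rmetric M p u v) \<and>
        (u \<noteq> 0 \<longrightarrow> rmetric M p u u > 0)) \<and>
     (\<forall>c\<in>atlas M. \<forall>a b. smooth_on (coord c ` chart_dom c) (\<lambda>z. metric_in_chart M c z a b))"


section \<open>Differentials and gradients\<close>

text \<open>Differentials are computed in an arbitrary chart around the base point; on maps that are
  differentiable there and on tangent vectors, the result does not depend on the chart.\<close>

definition some_chart :: "('a, 'e) rmanifold \<Rightarrow> 'a \<Rightarrow> ('a, 'e) chart" where
  "some_chart M p = (SOME c. c \<in> charts_at M p)"

definition fun_differentiable ::
  "('a, 'e::euclidean_space) rmanifold \<Rightarrow> ('a \<Rightarrow> real) \<Rightarrow> 'a \<Rightarrow> bool" where
  "fun_differentiable M \<phi> p \<longleftrightarrow>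
     (\<forall>c\<in>charts_at M p. (\<phi> \<circ> chart_inv c) differentiable (at (coord c p)))"

definition fun_diff ::
  "('a, 'e::euclidean_space) rmanifold \<Rightarrow> ('a \<Rightarrow> 'v::real_normed_vector) \<Rightarrow> 'a \<Rightarrow> ('a, 'e) tvec \<Rightarrow> 'v"
  where
  "fun_diff M \<phi> p v = (let c = some_chart M p in
     frechet_derivative (\<phi> \<circ> chart_inv c) (at (coord c p)) (v c))"

definition map_differentiable ::
  "('a::t2_space, 'e::euclidean_space) rmanifold \<Rightarrow> ('b::topological_space, 'f::euclidean_space) rmanifold
     \<Rightarrow> ('a \<Rightarrow> 'b) \<Rightarrow> 'a \<Rightarrow> bool" where
  "map_differentiable M N \<Phi> p \<longleftrightarrow> continuous (at p) \<Phi> \<and>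
     (\<forall>c\<in>charts_at M p. \<forall>d\<in>charts_at N (\<Phi> p).
        (coord d \<circ> \<Phi> \<circ> chart_inv c) differentiable (at (coord c p)))"

definition map_diff ::
  "('a, 'e::euclidean_space) rmanifold \<Rightarrow> ('b, 'f::euclidean_space) rmanifold
     \<Rightarrow> ('a \<Rightarrow> 'b) \<Rightarrow> 'a \<Rightarrow> ('a, 'e) tvec \<Rightarrow> ('b, 'f) tvec" where
  "map_diff M N \<Phi> p v = (\<lambda>d. if d \<in> charts_at N (\<Phi> p)
     then fun_diff M (coord d \<circ> \<Phi>) p v else 0)"

definition gradient ::
  "('a, 'e::euclidean_space) rmanifold \<Rightarrow> ('a \<Rightarrow> real) \<Rightarrow> 'a \<Rightarrow> ('a, 'e) tvec" where
  "gradient M \<phi> p = (THE w. w \<in> tangent_space M p \<and>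
     (\<forall>v\<in>tangent_space M p. rmetric M p w v = fun_diff M \<phi> p v))"


section \<open>Levi-Civita connection and Hessian\<close>

text \<open>The Christoffel symbols of the chart \<open>c\<close>, as a bilinear map \<open>\<Gamma>(a, b)\<close> given by the Koszul
  formula for constant vector fields:
  \<open>2 G(\<Gamma>(a, b), e) = \<partial>\<^sub>a G(b, e) + \<partial>\<^sub>b G(a, e) - \<partial>\<^sub>e G(a, b)\<close>.\<close>

definition christoffel ::
  "('a, 'e::euclidean_space) rmanifold \<Rightarrow> ('a, 'e) chart \<Rightarrow> 'e \<Rightarrow> 'e \<Rightarrow> 'e \<Rightarrow> 'e" where
  "christoffel M c z a b = (THE w. \<forall>e. 2 * metric_in_chart M c z w e =
       frechet_derivative (\<lambda>z. metric_in_chart M c z b e) (at z) a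
     + frechet_derivative (\<lambda>z. metric_in_chart M c z a e) (at z) b
     - frechet_derivative (\<lambda>z. metric_in_chart M c z a b) (at z) e)"

definition covariant_derivative ::
  "('a, 'e::euclidean_space) rmanifold \<Rightarrow> ('a \<Rightarrow> ('a, 'e) tvec) \<Rightarrow> 'a \<Rightarrow> ('a, 'e) tvec \<Rightarrow> ('a, 'e) tvec"
  where
  "covariant_derivative M X p v = (\<lambda>c. if c \<in> charts_at M p
     then frechet_derivative (\<lambda>z. X (chart_inv c z) c) (at (coord c p)) (v c)
          + christoffel M c (coord c p) (v c) (X p c)
     else 0)"

definition hessian ::
  "('a, 'e::euclidean_space) rmanifold \<Rightarrow> ('a \<Rightarrow> real) \<Rightarrow> 'a \<Rightarrow> ('a, 'e) tvec \<Rightarrow> ('a, 'e) tvec" where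
  "hessian M h p v = covariant_derivative M (gradient M h) p v"


section \<open>Geodesics and geodesic strong convexity\<close>

text \<open>Curves are parametrised by \<open>[0, 1]\<close>, with one-sided derivatives at the endpoints.\<close>

definition velocity ::
  "('a, 'e::euclidean_space) rmanifold \<Rightarrow> (real \<Rightarrow> 'a) \<Rightarrow> real \<Rightarrow> ('a, 'e) tvec" where
  "velocity M \<gamma> t = (\<lambda>c. if c \<in> charts_at M (\<gamma> t)
     then vector_derivative (\<lambda>s. coord c (\<gamma> s)) (at t within {0..1}) else 0)"

definition geodesic ::
  "('a::topological_space, 'e::euclidean_space) rmanifold \<Rightarrow> (real \<Rightarrow> 'a) \<Rightarrow> bool" where
  "geodesic M \<gamma> \<longleftrightarrow> continuous_on {0..1} \<gamma> \<and>
     (\<forall>t\<in>{0..1}. \<forall>c\<in>charts_at M (\<gamma> t).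
        (\<lambda>s. coord c (\<gamma> s)) differentiable (at t within {0..1}) \<and>
        ((\<lambda>s. velocity M \<gamma> s c) has_vector_derivative
           - christoffel M c (coord c (\<gamma> t)) (velocity M \<gamma> t c) (velocity M \<gamma> t c))
          (at t within {0..1}))"

definition geodesically_convex ::
  "('a::topological_space, 'e::euclidean_space) rmanifold \<Rightarrow> bool" where
  "geodesically_convex M \<longleftrightarrow> (\<forall>p q. \<exists>\<gamma>. geodesic M \<gamma> \<and> \<gamma> 0 = p \<and> \<gamma> 1 = q)"

text \<open>With \<open>z = \<gamma> 0\<close> and \<open>u\<close> the initial velocity of the geodesic \<open>\<gamma>\<close>, the point \<open>\<gamma> t\<close> is
  \<open>Exp\<^sub>z (t u)\<close>.\<close>

definition geodesic_strongly_convex ::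
  "('a::topological_space, 'e::euclidean_space) rmanifold \<Rightarrow> real \<Rightarrow> ('a \<Rightarrow> real) \<Rightarrow> bool" where
  "geodesic_strongly_convex M \<mu> h \<longleftrightarrow> \<mu> > 0 \<and>
     (\<forall>\<gamma>. geodesic M \<gamma> \<longrightarrow> (\<forall>t\<in>{0..1}.
        (let z = \<gamma> 0; u = velocity M \<gamma> 0 in
           h (\<gamma> t) \<ge> h z + t * rmetric M z (gradient M h z) u + t\<^sup>2 * (\<mu> / 2) * rmetric M z u u)))"


section \<open>Partial and cross derivatives\<close>

definition grad_x ::
  "('a, 'e::euclidean_space) rmanifold \<Rightarrow> ('a \<times> 'b \<Rightarrow> real) \<Rightarrow> 'a \<Rightarrow> 'b \<Rightarrow> ('a, 'e) tvec" where
  "grad_x Mx \<phi> x y = gradient Mx (\<lambda>x'. \<phi> (x', y)) x"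

definition grad_y ::
  "('b, 'f::euclidean_space) rmanifold \<Rightarrow> ('a \<times> 'b \<Rightarrow> real) \<Rightarrow> 'a \<Rightarrow> 'b \<Rightarrow> ('b, 'f) tvec" where
  "grad_y My \<phi> x y = gradient My (\<lambda>y'. \<phi> (x, y')) y"

definition hess_y ::
  "('b, 'f::euclidean_space) rmanifold \<Rightarrow> ('a \<times> 'b \<Rightarrow> real) \<Rightarrow> 'a \<Rightarrow> 'b \<Rightarrow> ('b, 'f) tvec \<Rightarrow> ('b, 'f) tvec"
  where
  "hess_y My \<phi> x y = hessian My (\<lambda>y'. \<phi> (x, y')) y"

definition hess_y_inv ::
  "('b, 'f::euclidean_space) rmanifold \<Rightarrow> ('a \<times> 'b \<Rightarrow> real) \<Rightarrow> 'a \<Rightarrow> 'b \<Rightarrow> ('b, 'f) tvec \<Rightarrow> ('b, 'f) tvec"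
  where
  "hess_y_inv My \<phi> x y = inv_into (tangent_space My y) (hess_y My \<phi> x y)"

text \<open>The maps differentiated here, \<open>y \<mapsto> grad_x Mx \<phi> x y\<close> and \<open>x \<mapsto> grad_y My \<phi> x y\<close>, take values
  in a single finite-dimensional vector space (the tangent space at the fixed point), so their
  differentials are taken entrywise.\<close>

definition cross_xy ::
  "('a, 'e::euclidean_space) rmanifold \<Rightarrow> ('b, 'f::euclidean_space) rmanifold \<Rightarrow> ('a \<times> 'b \<Rightarrow> real)
     \<Rightarrow> 'a \<Rightarrow> 'b \<Rightarrow> ('b, 'f) tvec \<Rightarrow> ('a, 'e) tvec" where
  "cross_xy Mx My \<phi> x y v = (\<lambda>c. fun_diff My (\<lambda>y'. grad_x Mx \<phi> x y' c) y v)"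

definition cross_yx ::
  "('a, 'e::euclidean_space) rmanifold \<Rightarrow> ('b, 'f::euclidean_space) rmanifold \<Rightarrow> ('a \<times> 'b \<Rightarrow> real)
     \<Rightarrow> 'a \<Rightarrow> 'b \<Rightarrow> ('a, 'e) tvec \<Rightarrow> ('b, 'f) tvec" where
  "cross_yx Mx My \<phi> x y u = (\<lambda>d. fun_diff Mx (\<lambda>x'. grad_y My \<phi> x' y d) x u)"

end

theory Submission
  imports Defs
begin

text \<open>
  In charts \<open>c\<close> around \<open>x\<close> and \<open>d\<close> around \<open>ystar x\<close>, let \<open>G (z, w)\<close> be the function \<open>g\<close>, and let \<open>B\<close> be its
  second derivative at the base point. The minimizer satisfies \<open>\<partial>\<^sub>w G (z, w) = 0\<close>. If \<open>B\<close> is positive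
  definite in the \<open>w\<close>-directions, the implicit function theorem solves this equation near the base
  point by a differentiable function; differentiating the equation gives the formula for \<open>D ystar\<close>, and
  the chain rule together with the symmetry of \<open>B\<close> gives the hypergradient. Three points need an
  argument.

  Positivity of \<open>B\<close> has to be extracted from an inequality for \<open>h = g (x, \<cdot>)\<close> along geodesics \<open>\<gamma>\<close> on
  \<open>[0, 1]\<close>. At the minimizer \<open>p\<close> it reads \<open>h (\<gamma> 1) \<ge> h p + \<mu> / 2 \<bar>u\<bar>\<^sup>2\<close> with \<open>u\<close> the initial velocity. Since the speed of a
  geodesic is constant (lemma \<open>geodesic_speed_constant\<close>), \<open>\<bar>u\<bar>\<close> is the length of \<open>\<gamma>\<close>, which is at least
  a constant times the distance of the endpoints in a chart (lemma \<open>geodesic_initial_speed_ge\<close>). As all points near \<open>p\<close> are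
  joined to \<open>p\<close> by a geodesic, \<open>h\<close> grows quadratically in the chart, and the second derivative is
  positive definite (lemma \<open>second_derivative_pos_at_critical_point\<close>).

  The local solution has to be identified with the global minimizer. Strong convexity and geodesic
  convexity make every critical point of \<open>g (x, \<cdot>)\<close> a minimizer, so the solution of the equation is
  \<open>ystar\<close> (lemma \<open>ystar_in_charts\<close>).

  The invariant operators have to be related to \<open>B\<close>. The Hessian differentiates a gradient, whose chart
  expression solves a linear system given by the metric. At a critical point the gradient vanishes, so
  the derivatives of the metric, of the coordinate changes and the Christoffel term all disappear, and
  the Hessian is tangent and represents \<open>B\<close> with respect to the metric (lemmas
  \<open>hessian_in_tangent_space\<close> and \<open>rmetric_hessian_at_critical_point\<close>). The cross derivatives
  differentiate gradients at a fixed point, where the metric is constant, so they represent the mixed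
  part of \<open>B\<close> (lemma \<open>cross_derivative\<close>). Everything is then compared through inner products with
  tangent vectors.
\<close>


section \<open>Calculus in Euclidean spaces\<close>

lemma linear_euclidean_expansion:
  fixes L :: "'a::euclidean_space \<Rightarrow> 'b::real_vector"
  assumes "linear L"
  shows "(\<Sum>i\<in>Basis. (a \<bullet> i) *\<^sub>R L i) = L a"
proof -
  have "L a = L (\<Sum>i\<in>Basis. (a \<bullet> i) *\<^sub>R i)"
    by (simp add: euclidean_representation)
  then show ?thesis
    using assms by (simp add: linear_sum linear_cmul)
qed

lemma Ck_on_cong:
  assumes "open S" and "\<And>x. x \<in> S \<Longrightarrow> f x = g x" and "Ck_on k S f"
  shows "Ck_on k S g"
  using assms(2,3)
proof (induction k arbitrary: f g)
  case 0
  then show ?case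
    by (simp cong: continuous_on_cong)
next
  case (Suc k)
  have diff: "f differentiable (at x)" if "x \<in> S" for x
    using Suc.prems that by simp
  have eq: "frechet_derivative f (at x) = frechet_derivative g (at x)" if "x \<in> S" for x
    by (rule frechet_derivative_transform_within_open[OF diff[OF that] assms(1) that Suc.prems(1)])
  have "g differentiable (at x)" if "x \<in> S" for x
    using has_derivative_transform_within_open[OF diff[OF that, unfolded frechet_derivative_works]
        assms(1) that Suc.prems(1)]
    by (auto simp: differentiable_def)
  moreover have "Ck_on k S (\<lambda>x. frechet_derivative g (at x) v)" for v
    by (rule Suc.IH[of "\<lambda>x. frechet_derivative f (at x) v"]) (use Suc.prems eq in auto)
  ultimately show ?case
    by simp
qed

lemma smooth_on_cong:
  "open S \<Longrightarrow> (\<And>x. x \<in> S \<Longrightarrow> f x = g x) \<Longrightarrow> smooth_on S f \<Longrightarrow> smooth_on S g"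
  unfolding smooth_on_def by (blast intro: Ck_on_cong)

lemma smooth_on_imp_differentiable:
  assumes "smooth_on S f" "x \<in> S"
  shows "f differentiable (at x)"
  using assms(1)[unfolded smooth_on_def, rule_format, of "Suc 0"] assms(2) by simp

lemma smooth_on_imp_has_derivative:
  "smooth_on S f \<Longrightarrow> x \<in> S \<Longrightarrow> (f has_derivative frechet_derivative f (at x)) (at x)"
  using smooth_on_imp_differentiable frechet_derivative_works by blast

lemma smooth_on_imp_continuous_on:
  assumes "smooth_on S f"
  shows "continuous_on S f"
  using assms[unfolded smooth_on_def, rule_format, of 0] by simp

lemma smooth_on_frechet_derivative:
  assumes "smooth_on S f"
  shows "smooth_on S (\<lambda>x. frechet_derivative f (at x) v)"
  unfolding smooth_on_def
proof
  fix k
  show "Ck_on k S (\<lambda>x. frechet_derivative f (at x) v)"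
    using assms[unfolded smooth_on_def, rule_format, of "Suc k"] by simp
qed

text \<open>The last argument is the direction of the inner derivative, the one before it that of the outer one.\<close>

definition second_derivative ::
  "('a::real_normed_vector \<Rightarrow> 'b::real_normed_vector) \<Rightarrow> 'a \<Rightarrow> 'a \<Rightarrow> 'a \<Rightarrow> 'b" where
  "second_derivative f x u v = frechet_derivative (\<lambda>y. frechet_derivative f (at y) v) (at x) u"

text \<open>The second difference of \<open>f\<close> along \<open>u\<close> and \<open>v\<close> is the increment over \<open>h u\<close> of
  \<open>s \<mapsto> f (x + s u + h v) - f (x + s u)\<close>; the mean value theorem turns it into a first difference
  of the derivative along \<open>u\<close>, whose leading term is the second derivative.\<close>

lemma second_difference_tendsto:
  fixes f :: "'a::real_normed_vector \<Rightarrow> real"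
  assumes S: "open S" "x \<in> S" and f: "\<And>y. y \<in> S \<Longrightarrow> f differentiable (at y)"
    and d: "(\<lambda>y. frechet_derivative f (at y) u) differentiable (at x)"
  shows "((\<lambda>h. (f (x + h *\<^sub>R u + h *\<^sub>R v) - f (x + h *\<^sub>R u) - f (x + h *\<^sub>R v) + f x) / h\<^sup>2)
           \<longlongrightarrow> second_derivative f x v u) (at_right 0)"
proof (rule tendstoI)
  fix e :: real
  assume e: "0 < e"
  define D where "D = (\<lambda>y. frechet_derivative f (at y))"
  define L where "L = (\<lambda>a. second_derivative f x a u)"
  have L: "((\<lambda>y. D y u) has_derivative L) (at x)"
    using d unfolding L_def D_def second_derivative_def frechet_derivative_works by simp
  interpret L: bounded_linear L
    using L by (rule has_derivative_bounded_linear)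
  \<comment> \<open>Below \<open>h0\<close>, the parallelogram with sides \<open>h u\<close> and \<open>h v\<close> lies in \<open>S\<close> and in the ball where the
    derivative along \<open>u\<close> is approximated up to the factor \<open>e'\<close>; the approximation is used twice.\<close>
  define m where "m = norm u + norm v + 1"
  have m: "m > 0" "norm u + norm v < m"
    unfolding m_def using norm_ge_zero[of u] norm_ge_zero[of v] by linarith+
  define e' where "e' = e / (4 * m)"
  have e': "e' > 0" "2 * e' * m < e"
    using e m by (auto simp: e'_def)
  obtain r where r: "r > 0" "ball x r \<subseteq> S"
    using S open_contains_ball by blast
  obtain d where d: "d > 0"
      "\<And>y. norm (y - x) < d \<Longrightarrow> norm (D y u - D x u - L (y - x)) \<le> e' * norm (y - x)"
    using L e'(1) unfolding has_derivative_at_alt by blast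
  define h0 where "h0 = min r d / m"
  have h0: "h0 > 0"
    using r d m by (simp add: h0_def)
  have main: "dist ((f (x + h *\<^sub>R u + h *\<^sub>R v) - f (x + h *\<^sub>R u) - f (x + h *\<^sub>R v) + f x) / h\<^sup>2)
      (L v) < e" if h: "0 < h" "h < h0" for h
  proof -
    have hm: "h * m < min r d"
      using h m by (simp add: h0_def pos_less_divide_eq)
    have small: "norm (s *\<^sub>R u + t *\<^sub>R v) \<le> h * m" if "\<bar>s\<bar> \<le> h" "\<bar>t\<bar> \<le> h" for s t
    proof -
      have "norm (s *\<^sub>R u + t *\<^sub>R v) \<le> \<bar>s\<bar> * norm u + \<bar>t\<bar> * norm v"
        using norm_triangle_ineq[of "s *\<^sub>R u" "t *\<^sub>R v"] by simp
      also have "\<dots> \<le> h * norm u + h * norm v"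
        using that by (intro add_mono mult_right_mono) auto
      also have "\<dots> \<le> h * m"
        using m h by (simp add: distrib_left[symmetric] mult_left_mono)
      finally show ?thesis .
    qed
    have inS: "x + s *\<^sub>R u + t *\<^sub>R v \<in> S" if "\<bar>s\<bar> \<le> h" "\<bar>t\<bar> \<le> h" for s t
    proof -
      have "x - (x + s *\<^sub>R u + t *\<^sub>R v) = - (s *\<^sub>R u + t *\<^sub>R v)"
        by simp
      then have "dist x (x + s *\<^sub>R u + t *\<^sub>R v) = norm (s *\<^sub>R u + t *\<^sub>R v)"
        unfolding dist_norm by (simp only: norm_minus_cancel)
      then show ?thesis
        using small[OF that] hm r by auto
    qed
    define \<phi> where "\<phi> = (\<lambda>s. f (x + s *\<^sub>R u + h *\<^sub>R v) - f (x + s *\<^sub>R u + 0 *\<^sub>R v))"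
    have dline: "((\<lambda>s. f (x + s *\<^sub>R u + t *\<^sub>R v)) has_derivative
        (\<lambda>\<sigma>. \<sigma> * D (x + s *\<^sub>R u + t *\<^sub>R v) u)) (at s within {0..h})"
      if "\<bar>s\<bar> \<le> h" "\<bar>t\<bar> \<le> h" for s t
    proof -
      let ?y = "x + s *\<^sub>R u + t *\<^sub>R v"
      have f': "(f has_derivative D ?y) (at ?y)"
        using f[OF inS[OF that]] unfolding D_def frechet_derivative_works .
      have "((\<lambda>s. x + s *\<^sub>R u + t *\<^sub>R v) has_derivative (\<lambda>\<sigma>. \<sigma> *\<^sub>R u)) (at s within {0..h})"
        by (auto intro!: derivative_eq_intros)
      from has_derivative_compose[OF this f'] show ?thesis
        using linear_cmul[OF has_derivative_linear[OF f']] by simp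
    qed
    have "\<exists>\<theta>\<in>{0<..<h}. \<phi> h - \<phi> 0 =
        (h - 0) * D (x + \<theta> *\<^sub>R u + h *\<^sub>R v) u - (h - 0) * D (x + \<theta> *\<^sub>R u + 0 *\<^sub>R v) u"
      unfolding \<phi>_def
      by (rule mvt_simple[OF h(1)], intro has_derivative_diff dline) (use h in auto)
    then obtain \<theta> where \<theta>: "0 < \<theta>" "\<theta> < h" and
      \<Delta>: "\<phi> h - \<phi> 0 = h * (D (x + \<theta> *\<^sub>R u + h *\<^sub>R v) u - D (x + \<theta> *\<^sub>R u) u)"
      by (auto simp: algebra_simps)
    have a: "\<bar>D (x + \<theta> *\<^sub>R u + h *\<^sub>R v) u - D x u - L (\<theta> *\<^sub>R u + h *\<^sub>R v)\<bar> \<le> e' * (h * m)"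
    proof -
      have "\<bar>D (x + \<theta> *\<^sub>R u + h *\<^sub>R v) u - D x u - L (\<theta> *\<^sub>R u + h *\<^sub>R v)\<bar>
          \<le> e' * norm (\<theta> *\<^sub>R u + h *\<^sub>R v)"
        using d(2)[of "x + \<theta> *\<^sub>R u + h *\<^sub>R v"] small[of \<theta> h] hm \<theta> by (simp add: add.assoc)
      also have "\<dots> \<le> e' * (h * m)"
        using small[of \<theta> h] \<theta> e' by (intro mult_left_mono) auto
      finally show ?thesis .
    qed
    have b: "\<bar>D (x + \<theta> *\<^sub>R u) u - D x u - L (\<theta> *\<^sub>R u)\<bar> \<le> e' * (h * m)"
    proof -
      have "\<bar>D (x + \<theta> *\<^sub>R u) u - D x u - L (\<theta> *\<^sub>R u)\<bar> \<le> e' * norm (\<theta> *\<^sub>R u)"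
        using d(2)[of "x + \<theta> *\<^sub>R u"] small[of \<theta> 0] hm \<theta> by simp
      also have "\<dots> \<le> e' * (h * m)"
        using small[of \<theta> 0] \<theta> e' h by (intro mult_left_mono) auto
      finally show ?thesis .
    qed
    have "\<bar>D (x + \<theta> *\<^sub>R u + h *\<^sub>R v) u - D (x + \<theta> *\<^sub>R u) u - h * L v\<bar> \<le> 2 * (e' * (h * m))"
      using a b by (simp add: L.add L.scaleR abs_le_iff)
    also have "\<dots> < e * h"
      using mult_strict_right_mono[OF e'(2) h(1)] by (simp add: ac_simps)
    finally have "\<bar>(D (x + \<theta> *\<^sub>R u + h *\<^sub>R v) u - D (x + \<theta> *\<^sub>R u) u) / h - L v\<bar> < e"
      using h by (simp add: abs_less_iff field_simps)
    moreover have "(f (x + h *\<^sub>R u + h *\<^sub>R v) - f (x + h *\<^sub>R u) - f (x + h *\<^sub>R v) + f x) / h\<^sup>2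
        = (D (x + \<theta> *\<^sub>R u + h *\<^sub>R v) u - D (x + \<theta> *\<^sub>R u) u) / h"
    proof -
      have "f (x + h *\<^sub>R u + h *\<^sub>R v) - f (x + h *\<^sub>R u) - f (x + h *\<^sub>R v) + f x = \<phi> h - \<phi> 0"
        by (simp add: \<phi>_def)
      then show ?thesis
        using \<Delta> h by (simp add: power2_eq_square)
    qed
    ultimately show ?thesis
      by (simp add: dist_real_def)
  qed
  show "\<forall>\<^sub>F h in at_right 0.
      dist ((f (x + h *\<^sub>R u + h *\<^sub>R v) - f (x + h *\<^sub>R u) - f (x + h *\<^sub>R v) + f x) / h\<^sup>2)
        (second_derivative f x v u) < e"
    unfolding eventually_at_right_field using main h0 by (auto simp: L_def)
qed

text \<open>The second difference is symmetric in the two directions, so both orders of differentiation have the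
  same limit.\<close>

lemma second_derivative_symmetric:
  fixes f :: "'a::real_normed_vector \<Rightarrow> real"
  assumes S: "open S" "x \<in> S" and f: "\<And>y. y \<in> S \<Longrightarrow> f differentiable (at y)"
    and d: "\<And>w. (\<lambda>y. frechet_derivative f (at y) w) differentiable (at x)"
  shows "second_derivative f x u v = second_derivative f x v u"
proof (rule tendsto_unique)
  show "((\<lambda>h. (f (x + h *\<^sub>R u + h *\<^sub>R v) - f (x + h *\<^sub>R u) - f (x + h *\<^sub>R v) + f x) / h\<^sup>2)
           \<longlongrightarrow> second_derivative f x v u) (at_right 0)"
    by (rule second_difference_tendsto[OF S f d])
  have "((\<lambda>h. (f (x + h *\<^sub>R v + h *\<^sub>R u) - f (x + h *\<^sub>R v) - f (x + h *\<^sub>R u) + f x) / h\<^sup>2)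
           \<longlongrightarrow> second_derivative f x u v) (at_right 0)"
    by (rule second_difference_tendsto[OF S f d])
  then show "((\<lambda>h. (f (x + h *\<^sub>R u + h *\<^sub>R v) - f (x + h *\<^sub>R u) - f (x + h *\<^sub>R v) + f x) / h\<^sup>2)
           \<longlongrightarrow> second_derivative f x u v) (at_right 0)"
    by (simp add: algebra_simps)
qed simp

text \<open>If the second derivative along \<open>a\<close> were below \<open>c < 2 \<kappa> \<bar>a\<bar>\<^sup>2\<close>, the first derivative along the ray
  \<open>w + t a\<close> would stay below \<open>c t\<close> for small \<open>t\<close>, and by the mean value theorem the growth along the
  ray would stay below \<open>c t\<^sup>2 / 2\<close>.\<close>

lemma second_derivative_ge_quadratic_growth:
  fixes h :: "'a::real_normed_vector \<Rightarrow> real"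
  assumes S: "open S" "w \<in> S" and h: "\<And>y. y \<in> S \<Longrightarrow> h differentiable (at y)"
    and d: "(\<lambda>y. frechet_derivative h (at y) a) differentiable (at w)"
    and crit: "frechet_derivative h (at w) a = 0"
    and growth: "\<And>y. y \<in> S \<Longrightarrow> h w + \<kappa> * (norm (y - w))\<^sup>2 \<le> h y"
  shows "2 * \<kappa> * (norm a)\<^sup>2 \<le> second_derivative h w a a"
proof (rule ccontr)
  assume "\<not> ?thesis"
  then obtain c where c: "second_derivative h w a a < c" "c < 2 * \<kappa> * (norm a)\<^sup>2"
    using dense not_le by blast
  define D where "D = (\<lambda>y. frechet_derivative h (at y) a)"
  define \<psi> where "\<psi> = (\<lambda>t. D (w + t *\<^sub>R a))"
  have D: "(D has_derivative (\<lambda>b. second_derivative h w b a)) (at w)"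
    using d unfolding D_def second_derivative_def frechet_derivative_works by simp
  have "((\<lambda>t. w + t *\<^sub>R a) has_derivative (\<lambda>\<sigma>. \<sigma> *\<^sub>R a)) (at 0)"
    by (auto intro!: derivative_eq_intros)
  from has_derivative_compose[OF this, of D "\<lambda>b. second_derivative h w b a"] D
  have "(\<psi> has_derivative (\<lambda>\<sigma>. second_derivative h w (\<sigma> *\<^sub>R a) a)) (at 0)"
    by (simp add: \<psi>_def)
  then have "(\<psi> has_derivative (\<lambda>\<sigma>. second_derivative h w a a * \<sigma>)) (at 0)"
    using linear_cmul[OF has_derivative_linear[OF D]] by (simp add: mult.commute)
  then have "(\<psi> has_real_derivative second_derivative h w a a) (at 0)"
    unfolding has_field_derivative_def .
  then have "((\<lambda>t. \<psi> t / t) \<longlongrightarrow> second_derivative h w a a) (at 0)"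
    using crit by (simp add: has_field_derivative_iff \<psi>_def D_def)
  then have "\<forall>\<^sub>F t in at 0. \<psi> t / t < c"
    using c(1) by (rule order_tendstoD)
  then obtain d where d: "d > 0" "\<And>t. t \<noteq> 0 \<Longrightarrow> \<bar>t\<bar> < d \<Longrightarrow> \<psi> t / t < c"
    unfolding eventually_at by auto
  obtain r where r: "r > 0" "ball w r \<subseteq> S"
    using S open_contains_ball by blast
  have na: "norm a + 1 > 0"
    using norm_ge_zero[of a] by linarith
  obtain T where T: "0 < T" "T < d" "T < r / (norm a + 1)"
    using field_lbound_gt_zero[OF d(1) divide_pos_pos[OF r(1) na]] by blast
  have Tr: "T * norm a < r"
  proof -
    have "T * norm a \<le> T * (norm a + 1)"
      using T by simp
    also have "\<dots> < r"
      using T na by (simp add: pos_less_divide_eq)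
    finally show ?thesis .
  qed
  have inS: "w + t *\<^sub>R a \<in> S" if "0 \<le> t" "t \<le> T" for t
  proof -
    have "t * norm a \<le> T * norm a"
      using that by (intro mult_right_mono) auto
    then have "w + t *\<^sub>R a \<in> ball w r"
      using Tr that by (simp add: dist_norm)
    then show ?thesis
      using r by blast
  qed
  have "\<exists>t\<in>{0<..<T}. (h (w + T *\<^sub>R a) - c * T\<^sup>2 / 2) - (h (w + 0 *\<^sub>R a) - c * 0\<^sup>2 / 2) =
      (T - 0) * \<psi> t - (T - 0) * (c * t)"
  proof (rule mvt_simple[OF T(1)])
    fix t
    assume t: "0 \<le> t" "t \<le> T"
    have h': "(h has_derivative frechet_derivative h (at (w + t *\<^sub>R a))) (at (w + t *\<^sub>R a))"
      using h[OF inS[OF t]] frechet_derivative_works by blast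
    have "((\<lambda>t. w + t *\<^sub>R a) has_derivative (\<lambda>\<sigma>. \<sigma> *\<^sub>R a)) (at t within {0..T})"
      by (auto intro!: derivative_eq_intros)
    from has_derivative_compose[OF this h']
    have "((\<lambda>t. h (w + t *\<^sub>R a)) has_derivative (\<lambda>\<sigma>. \<sigma> * \<psi> t)) (at t within {0..T})"
      using linear_cmul[OF has_derivative_linear[OF h']] by (simp add: \<psi>_def D_def)
    moreover have "((\<lambda>t. c * t\<^sup>2 / 2) has_derivative (\<lambda>\<sigma>. \<sigma> * (c * t))) (at t within {0..T})"
      by (auto intro!: derivative_eq_intros)
    ultimately show "((\<lambda>t. h (w + t *\<^sub>R a) - c * t\<^sup>2 / 2) has_derivative
        (\<lambda>\<sigma>. \<sigma> * \<psi> t - \<sigma> * (c * t))) (at t within {0..T})"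
      by (rule has_derivative_diff)
  qed
  then obtain t where t: "0 < t" "t < T"
    and eq: "h (w + T *\<^sub>R a) - c * T\<^sup>2 / 2 - h w = T * (\<psi> t - c * t)"
    by (auto simp: algebra_simps)
  have "\<psi> t < c * t"
    using d(2)[of t] t T by (simp add: pos_divide_less_eq)
  then have "h (w + T *\<^sub>R a) < h w + c * T\<^sup>2 / 2"
    using eq T mult_pos_neg[of T "\<psi> t - c * t"] by linarith
  also have "c * T\<^sup>2 / 2 \<le> \<kappa> * (norm (w + T *\<^sub>R a - w))\<^sup>2"
    using c(2) T mult_right_mono[of c "2 * \<kappa> * (norm a)\<^sup>2" "T\<^sup>2"]
    by (simp add: power_mult_distrib algebra_simps)
  finally show False
    using growth[OF inS[of T]] T by simp
qed

text \<open>If \<open>L z (A z) = r z\<close> and \<open>A\<close> vanishes at \<open>z0\<close>, the variation of the operators \<open>L z\<close> only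
  acts on the small vector \<open>A z\<close>. So \<open>A\<close> can be differentiated at \<open>z0\<close> as if \<open>L\<close> were constant,
  and continuity of \<open>L\<close> is enough.\<close>

lemma has_derivative_linear_equation_at_zero:
  fixes L :: "'p::real_normed_vector \<Rightarrow> 'q::euclidean_space \<Rightarrow> 'q"
  assumes S: "open S" "z0 \<in> S"
    and lin: "\<And>z. z \<in> S \<Longrightarrow> linear (L z)"
    and eq: "\<And>z. z \<in> S \<Longrightarrow> L z (A z) = r z"
    and A0: "A z0 = 0" and inj: "inj (L z0)"
    and r: "(r has_derivative r') (at z0)"
    and cont: "\<And>a. ((\<lambda>z. L z a) \<longlongrightarrow> L z0 a) (at z0)"
  obtains A' where "(A has_derivative A') (at z0)" "\<And>a. L z0 (A' a) = r' a"
proof -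
  have lin0: "linear (L z0)"
    using lin S by blast
  obtain J where J: "linear J" "\<And>a. J (L z0 a) = a" "\<And>b. L z0 (J b) = b"
    using linear_injective_isomorphism[OF lin0 inj] by auto
  obtain K where K: "K > 0" "\<And>b. norm (J b) \<le> K * norm b"
    using linear_bounded_pos[OF J(1)] by blast
  define \<delta> where "\<delta> = (\<lambda>z. \<Sum>i\<in>Basis. norm (L z i - L z0 i))"
  have "((\<lambda>z. \<Sum>i\<in>Basis. norm (L z i - L z0 i)) \<longlongrightarrow> (\<Sum>i\<in>Basis. norm (L z0 i - L z0 i))) (at z0)"
    by (intro tendsto_intros cont)
  then have \<delta>0: "(\<delta> \<longlongrightarrow> 0) (at z0)"
    by (simp add: \<delta>_def)
  have \<delta>: "norm (L z a - L z0 a) \<le> \<delta> z * norm a" if "z \<in> S" for z a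
  proof -
    have "L z a - L z0 a = (\<Sum>i\<in>Basis. (a \<bullet> i) *\<^sub>R (L z i - L z0 i))"
      by (simp add: scaleR_diff_right sum_subtractf linear_euclidean_expansion[OF lin[OF that]]
          linear_euclidean_expansion[OF lin0])
    also have "norm \<dots> \<le> (\<Sum>i\<in>Basis. norm ((a \<bullet> i) *\<^sub>R (L z i - L z0 i)))"
      by (rule norm_sum)
    also have "\<dots> \<le> (\<Sum>i\<in>Basis. norm (L z i - L z0 i) * norm a)"
      by (intro sum_mono) (simp add: mult.commute[of "norm (L _ _ - _)"] Basis_le_norm mult_right_mono)
    finally show ?thesis
      by (simp add: \<delta>_def sum_distrib_right)
  qed
  have r0: "r z0 = 0"
    using eq[OF S(2)] A0 linear_0[OF lin0] by simp
  interpret r': bounded_linear r'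
    using r by (rule has_derivative_bounded_linear)
  obtain C where C: "\<And>a. norm (r' a) \<le> norm a * C"
    using r'.bounded by blast
  define \<rho> where "\<rho> = (\<lambda>z. norm (r z - r' (z - z0)) / norm (z - z0))"
  have \<rho>: "(\<rho> \<longlongrightarrow> 0) (at z0)"
    using r r0 unfolding has_derivative_iff_norm \<rho>_def by simp
  have ev: "\<forall>\<^sub>F z in at z0. z \<in> S \<and> z \<noteq> z0 \<and> \<delta> z < 1 / (2 * K)"
    using eventually_at_in_open'[OF S] eventually_neq_at_within[of z0] order_tendstoD(2)[OF \<delta>0, of "1 / (2 * K)"] K
    by (auto elim!: eventually_elim2 simp: eventually_conj_iff)
  have bound: "norm (A z - A z0 - J (r' (z - z0))) / norm (z - z0)
      \<le> K * \<rho> z + K * \<delta> z * (2 * K * (\<rho> z + C))"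
    if z: "z \<in> S" "z \<noteq> z0" "\<delta> z < 1 / (2 * K)" for z
  proof -
    let ?n = "norm (z - z0)"
    have n: "?n > 0"
      using z by simp
    have Aeq: "A z = J (r z) - J (L z (A z) - L z0 (A z))"
      using eq[OF z(1)] J by (simp add: linear_diff)
    have \<delta>pos: "\<delta> z \<ge> 0"
      unfolding \<delta>_def by (intro sum_nonneg) auto
    have J2: "norm (J (L z (A z) - L z0 (A z))) \<le> K * \<delta> z * norm (A z)"
      using order_trans[OF K(2)[of "L z (A z) - L z0 (A z)"] mult_left_mono[OF \<delta>[OF z(1), of "A z"], of K]] K(1)
      by (simp add: mult.assoc)
    have "norm (A z) \<le> K * norm (r z) + K * \<delta> z * norm (A z)"
      using norm_triangle_ineq4[of "J (r z)" "J (L z (A z) - L z0 (A z))"] K(2)[of "r z"] J2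
        arg_cong[OF Aeq, of norm] by linarith
    moreover have "K * \<delta> z * norm (A z) \<le> 1 / 2 * norm (A z)"
      using z(3) K(1) by (intro mult_right_mono) (auto simp: field_simps)
    ultimately have A1: "norm (A z) \<le> 2 * K * norm (r z)"
      by linarith
    have "norm (r z) \<le> norm (r z - r' (z - z0)) + norm (r' (z - z0))"
      by (metis norm_triangle_sub add.commute)
    also have "\<dots> \<le> \<rho> z * ?n + C * ?n"
      using C[of "z - z0"] n by (simp add: \<rho>_def mult.commute)
    finally have r1: "norm (r z) \<le> (\<rho> z + C) * ?n"
      by (simp add: distrib_right)
    have A2: "norm (A z) \<le> 2 * K * (\<rho> z + C) * ?n"
      using order_trans[OF A1 mult_left_mono[OF r1, of "2 * K"]] K(1) by (simp add: mult.assoc)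
    have "A z - A z0 - J (r' (z - z0)) = J (r z - r' (z - z0)) - J (L z (A z) - L z0 (A z))"
      by (subst Aeq) (simp add: A0 linear_diff[OF J(1)])
    then have "norm (A z - A z0 - J (r' (z - z0)))
        \<le> norm (J (r z - r' (z - z0))) + norm (J (L z (A z) - L z0 (A z)))"
      using norm_triangle_ineq4 by metis
    also have "\<dots> \<le> K * (\<rho> z * ?n) + K * \<delta> z * (2 * K * (\<rho> z + C) * ?n)"
    proof (rule add_mono)
      show "norm (J (r z - r' (z - z0))) \<le> K * (\<rho> z * ?n)"
        using K(2)[of "r z - r' (z - z0)"] n by (simp add: \<rho>_def)
      show "norm (J (L z (A z) - L z0 (A z))) \<le> K * \<delta> z * (2 * K * (\<rho> z + C) * ?n)"
        by (rule order_trans[OF J2 mult_left_mono[OF A2]]) (use K(1) \<delta>pos in simp)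
    qed
    finally have "norm (A z - A z0 - J (r' (z - z0)))
        \<le> (K * \<rho> z + K * \<delta> z * (2 * K * (\<rho> z + C))) * ?n"
      by (simp add: algebra_simps)
    then show ?thesis
      using n by (simp add: pos_divide_le_eq)
  qed
  have lim: "((\<lambda>z. K * \<rho> z + K * \<delta> z * (2 * K * (\<rho> z + C))) \<longlongrightarrow> 0) (at z0)"
  proof -
    have "((\<lambda>z. K * \<rho> z + K * \<delta> z * (2 * K * (\<rho> z + C))) \<longlongrightarrow> K * 0 + K * 0 * (2 * K * (0 + C))) (at z0)"
      by (intro tendsto_intros \<rho> \<delta>0)
    then show ?thesis
      by simp
  qed
  have "((\<lambda>z. norm (A z - A z0 - J (r' (z - z0))) / norm (z - z0)) \<longlongrightarrow> 0) (at z0)"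
    by (rule tendsto_sandwich[OF _ eventually_mono[OF ev] tendsto_const lim]) (use bound in auto)
  then have "(A has_derivative (\<lambda>a. J (r' a))) (at z0)"
    unfolding has_derivative_iff_norm
    using bounded_linear_compose[OF J(1)[unfolded linear_conv_bounded_linear] r'.bounded_linear_axioms]
    by simp
  then show ?thesis
    using that J by blast
qed

text \<open>The inverse function theorem applies to \<open>(z, w) \<mapsto> (z, Q (z, w))\<close>; the solution \<open>\<eta> z\<close> is the second
  component of the preimage of \<open>(z, 0)\<close>. The equation for \<open>\<eta>'\<close> is \<open>Q (z, \<eta> z) = 0\<close> differentiated.\<close>

lemma implicit_function:
  fixes Q :: "'e::euclidean_space \<times> 'f::euclidean_space \<Rightarrow> 'f"
  assumes S: "open S" "(z0, w0) \<in> S"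
    and diff: "\<And>p. p \<in> S \<Longrightarrow> Q differentiable (at p)"
    and cont: "\<And>v. continuous_on S (\<lambda>p. frechet_derivative Q (at p) v)"
    and zero: "Q (z0, w0) = 0"
    and nondeg: "\<And>b. frechet_derivative Q (at (z0, w0)) (0, b) = 0 \<Longrightarrow> b = 0"
  obtains \<eta> \<eta>' where "\<eta> z0 = w0" "(\<eta> has_derivative \<eta>') (at z0)"
    "\<forall>\<^sub>F z in nhds z0. (z, \<eta> z) \<in> S \<and> Q (z, \<eta> z) = 0"
    "\<And>a. frechet_derivative Q (at (z0, w0)) (a, \<eta>' a) = 0"
proof -
  define Q' where "Q' = (\<lambda>p. frechet_derivative Q (at p))"
  have Q': "(Q has_derivative Q' p) (at p)" if "p \<in> S" for p
    using diff[OF that] unfolding Q'_def frechet_derivative_works .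
  define \<Psi> where "\<Psi> = (\<lambda>p. (fst p, Q p))"
  define \<Psi>' where "\<Psi>' = (\<lambda>p. Blinfun (\<lambda>v. (fst v, Q' p v)))"
  have \<Psi>d: "(\<Psi> has_derivative (\<lambda>v. (fst v, Q' p v))) (at p)" if "p \<in> S" for p
    unfolding \<Psi>_def by (intro has_derivative_Pair has_derivative_fst has_derivative_ident Q' that)
  have app: "blinfun_apply (\<Psi>' p) = (\<lambda>v. (fst v, Q' p v))" if "p \<in> S" for p
    unfolding \<Psi>'_def
    by (rule bounded_linear_Blinfun_apply[OF has_derivative_bounded_linear[OF \<Psi>d[OF that]]])
  have \<Psi>_deriv: "(\<Psi> has_derivative blinfun_apply (\<Psi>' p)) (at p)" if "p \<in> S" for p
    using \<Psi>d[OF that] app[OF that] by simp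
  have \<Psi>_cont: "continuous_on S \<Psi>'"
  proof (rule continuous_on_blinfun_componentwise)
    fix i :: "'e \<times> 'f"
    have "continuous_on S (\<lambda>p. (fst i, Q' p i))"
      unfolding Q'_def by (intro continuous_intros cont)
    then show "continuous_on S (\<lambda>p. blinfun_apply (\<Psi>' p) i)"
      by (rule continuous_on_eq) (simp add: app)
  qed
  have lin: "linear (blinfun_apply (\<Psi>' (z0, w0)))"
    using blinfun.bounded_linear_right linear_conv_bounded_linear by blast
  have "inj (blinfun_apply (\<Psi>' (z0, w0)))"
  proof (rule linear_injective_0[OF lin, THEN iffD2], intro allI impI)
    fix v
    assume "blinfun_apply (\<Psi>' (z0, w0)) v = 0"
    then have v: "fst v = 0" "Q' (z0, w0) v = 0"
      by (simp_all add: app[OF S(2)] zero_prod_def)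
    then have "Q' (z0, w0) (0, snd v) = 0"
      by (metis prod.collapse)
    then have "snd v = 0"
      using nondeg by (simp add: Q'_def)
    then show "v = 0"
      using v by (simp add: prod_eq_iff)
  qed
  then obtain J where J: "linear J" "\<And>a. J (blinfun_apply (\<Psi>' (z0, w0)) a) = a"
    using linear_injective_isomorphism[OF lin] by auto
  have invf: "Blinfun J o\<^sub>L \<Psi>' (z0, w0) = id_blinfun"
    by (rule blinfun_eqI)
      (simp add: bounded_linear_Blinfun_apply J linear_conv_bounded_linear[symmetric])
  from inverse_function_theorem[OF S(1) \<Psi>_deriv \<Psi>_cont S(2) invf]
  obtain U V k k' where U: "open U" "U \<subseteq> S" "(z0, w0) \<in> U" and V: "open V" "\<Psi> (z0, w0) \<in> V"
    and hom: "homeomorphism U V \<Psi> k"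
    and k': "\<And>y. y \<in> V \<Longrightarrow> (k has_derivative (k' y)) (at y)"
    by metis
  have \<Psi>0: "\<Psi> (z0, w0) = (z0, 0)"
    by (simp add: \<Psi>_def zero)
  define \<eta> where "\<eta> = (\<lambda>z. snd (k (z, 0)))"
  define \<eta>' where "\<eta>' = (\<lambda>a. snd (k' (z0, 0) (a, 0)))"
  have "((\<lambda>z. (z, 0::'f)) has_derivative (\<lambda>a. (a, 0))) (at z0)"
    by (intro has_derivative_Pair has_derivative_ident has_derivative_const)
  from has_derivative_snd[OF has_derivative_compose[OF this k'[of "(z0, 0)"]]]
  have \<eta>'_deriv: "(\<eta> has_derivative \<eta>') (at z0)"
    using V(2) \<Psi>0 by (simp add: \<eta>_def \<eta>'_def)
  have \<eta>0: "\<eta> z0 = w0"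
    using homeomorphism_apply1[OF hom U(3)] \<Psi>0 by (simp add: \<eta>_def)
  have openV: "open ((\<lambda>z. (z, 0::'f)) -` V)"
    by (intro open_vimage V continuous_intros)
  have "\<forall>\<^sub>F z in nhds z0. z \<in> (\<lambda>z. (z, 0::'f)) -` V"
    by (rule eventually_nhds_in_open[OF openV]) (use V(2) \<Psi>0 in simp)
  then have ev: "\<forall>\<^sub>F z in nhds z0. (z, \<eta> z) \<in> S \<and> Q (z, \<eta> z) = 0"
  proof (rule eventually_mono)
    fix z
    assume "z \<in> (\<lambda>z. (z, 0::'f)) -` V"
    then have z: "(z, 0) \<in> V"
      by simp
    have "\<Psi> (k (z, 0)) = (z, 0)"
      by (rule homeomorphism_apply2[OF hom z])
    then have "fst (k (z, 0)) = z" "Q (k (z, 0)) = 0"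
      by (simp_all add: \<Psi>_def)
    moreover from this have "k (z, 0) = (z, \<eta> z)"
      by (simp add: \<eta>_def prod_eq_iff)
    moreover have "k (z, 0) \<in> S"
      using hom z U(2) unfolding homeomorphism_def by blast
    ultimately show "(z, \<eta> z) \<in> S \<and> Q (z, \<eta> z) = 0"
      by simp
  qed
  have "((\<lambda>z. (z, \<eta> z)) has_derivative (\<lambda>a. (a, \<eta>' a))) (at z0)"
    by (intro has_derivative_Pair has_derivative_ident \<eta>'_deriv)
  from has_derivative_compose[OF this, of Q "Q' (z0, w0)"]
  have "((\<lambda>z. Q (z, \<eta> z)) has_derivative (\<lambda>a. Q' (z0, w0) (a, \<eta>' a))) (at z0)"
    using Q'[OF S(2)] by (simp add: \<eta>0)
  moreover have "((\<lambda>z. Q (z, \<eta> z)) has_derivative (\<lambda>a. 0)) (at z0)"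
  proof -
    have "\<forall>\<^sub>F z in nhds z0. Q (z, \<eta> z) = 0"
      using ev by (rule eventually_mono) simp
    then obtain N where "open N" "z0 \<in> N" "\<And>z. z \<in> N \<Longrightarrow> Q (z, \<eta> z) = 0"
      unfolding eventually_nhds by blast
    then show ?thesis
      by (intro has_derivative_transform_within_open[OF has_derivative_const[of 0]]) auto
  qed
  ultimately have "(\<lambda>a. Q' (z0, w0) (a, \<eta>' a)) = (\<lambda>a. 0)"
    by (rule has_derivative_unique)
  then show ?thesis
    using that[OF \<eta>0 \<eta>'_deriv ev] by (auto simp: Q'_def fun_eq_iff)
qed


section \<open>Charts, tangent vectors and gradients\<close>

text \<open>Indexed by the point instead of its coordinates, these maps compose like a groupoid.\<close>

definition chart_change ::
  "('a, 'e::euclidean_space) chart \<Rightarrow> ('a, 'e) chart \<Rightarrow> 'a \<Rightarrow> 'e \<Rightarrow> 'e" where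
  "chart_change c d p = frechet_derivative (transition c d) (at (coord c p))"

locale riemannian =
  fixes M :: "('a::{t2_space, second_countable_topology}, 'e::euclidean_space) rmanifold"
  assumes riemannian: "riemannian_manifold M"
begin

lemma smooth_atlas: "smooth_atlas (atlas M)"
  using riemannian by (simp only: riemannian_manifold_def)

lemma is_chart_atlas: "c \<in> atlas M \<Longrightarrow> is_chart c"
  using smooth_atlas by (simp add: smooth_atlas_def)

lemma open_chart_dom: "c \<in> atlas M \<Longrightarrow> open (chart_dom c)"
  and open_chart_image: "c \<in> atlas M \<Longrightarrow> open (coord c ` chart_dom c)"
  and chart_homeomorphism: "c \<in> atlas M \<Longrightarrow>
    homeomorphism (chart_dom c) (coord c ` chart_dom c) (coord c) (chart_inv c)"
  using is_chart_atlas unfolding is_chart_def by blast+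

lemma chart_inv_coord: "c \<in> atlas M \<Longrightarrow> p \<in> chart_dom c \<Longrightarrow> chart_inv c (coord c p) = p"
  by (rule homeomorphism_apply1[OF chart_homeomorphism])

lemma coord_chart_inv:
  "c \<in> atlas M \<Longrightarrow> z \<in> coord c ` chart_dom c \<Longrightarrow> coord c (chart_inv c z) = z"
  by (rule homeomorphism_apply2[OF chart_homeomorphism])

lemma chart_inv_in_dom:
  "c \<in> atlas M \<Longrightarrow> z \<in> coord c ` chart_dom c \<Longrightarrow> chart_inv c z \<in> chart_dom c"
  by (erule imageE) (simp only: chart_inv_coord)

lemma continuous_on_coord: "c \<in> atlas M \<Longrightarrow> continuous_on (chart_dom c) (coord c)"
  and continuous_on_chart_inv: "c \<in> atlas M \<Longrightarrow> continuous_on (coord c ` chart_dom c) (chart_inv c)"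
  using chart_homeomorphism unfolding homeomorphism_def by blast+

lemma in_coord_image_iff:
  assumes c: "c \<in> atlas M"
  shows "z \<in> coord c ` (chart_dom c \<inter> W) \<longleftrightarrow> z \<in> coord c ` chart_dom c \<and> chart_inv c z \<in> W"
    (is "?l = ?r")
proof
  assume ?l
  then show ?r
    using chart_inv_coord[OF c] by auto
next
  assume ?r
  then show ?l
    using coord_chart_inv[OF c, of z] chart_inv_in_dom[OF c, of z]
    by (intro image_eqI[of _ _ "chart_inv c z"]) auto
qed

lemma open_coord_image:
  assumes "c \<in> atlas M" "open W"
  shows "open (coord c ` (chart_dom c \<inter> W))"
proof -
  have "coord c ` (chart_dom c \<inter> W) = coord c ` chart_dom c \<inter> chart_inv c -` W"
    using in_coord_image_iff[OF assms(1)] by auto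
  then show ?thesis
    using continuous_open_preimage[OF continuous_on_chart_inv open_chart_image assms(2)] assms(1)
    by simp
qed

lemma charts_atD: "c \<in> charts_at M p \<Longrightarrow> c \<in> atlas M" "c \<in> charts_at M p \<Longrightarrow> p \<in> chart_dom c"
  by (auto simp: charts_at_def)

lemma charts_at_chart_inv:
  "c \<in> atlas M \<Longrightarrow> z \<in> coord c ` chart_dom c \<Longrightarrow> c \<in> charts_at M (chart_inv c z)"
  by (simp add: charts_at_def chart_inv_in_dom)

lemma coord_in_image: "c \<in> charts_at M p \<Longrightarrow> coord c p \<in> coord c ` chart_dom c"
  by (simp add: charts_at_def)

lemma chart_inv_coord_at: "c \<in> charts_at M p \<Longrightarrow> chart_inv c (coord c p) = p"
  by (simp add: charts_at_def chart_inv_coord)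

lemma some_chart_in: "some_chart M p \<in> charts_at M p"
proof -
  have "p \<in> (\<Union>c\<in>atlas M. chart_dom c)"
    using smooth_atlas by (simp add: smooth_atlas_def)
  then have "\<exists>c. c \<in> charts_at M p"
    by (auto simp: charts_at_def)
  then show ?thesis
    unfolding some_chart_def by (rule someI_ex)
qed


lemma smooth_on_transition:
  assumes "c \<in> atlas M" "d \<in> atlas M"
  shows "smooth_on (coord c ` (chart_dom c \<inter> chart_dom d)) (transition c d)"
  using smooth_atlas assms by (simp add: smooth_atlas_def)

lemma coord_in_overlap:
  "c \<in> charts_at M p \<Longrightarrow> d \<in> charts_at M p \<Longrightarrow> coord c p \<in> coord c ` (chart_dom c \<inter> chart_dom d)"
  by (simp add: charts_at_def)

lemma transition_has_derivative:
  assumes "c \<in> charts_at M p" "d \<in> charts_at M p"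
  shows "(transition c d has_derivative chart_change c d p) (at (coord c p))"
  unfolding chart_change_def
  by (rule smooth_on_imp_has_derivative[OF smooth_on_transition coord_in_overlap[OF assms]])
    (rule charts_atD[OF assms(1)] charts_atD[OF assms(2)])+

lemma linear_chart_change:
  "c \<in> charts_at M p \<Longrightarrow> d \<in> charts_at M p \<Longrightarrow> linear (chart_change c d p)"
  using transition_has_derivative has_derivative_linear by blast

lemma transition_coord: "c \<in> charts_at M p \<Longrightarrow> transition c d (coord c p) = coord d p"
  by (simp add: transition_def chart_inv_coord_at)

lemma chart_rep_change:
  fixes \<phi> :: "'a \<Rightarrow> 'v::real_normed_vector"
  assumes c: "c \<in> charts_at M p" and d: "d \<in> charts_at M p"
    and \<phi>: "((\<phi> \<circ> chart_inv c) has_derivative D) (at (coord c p))"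
  shows "((\<phi> \<circ> chart_inv d) has_derivative (\<lambda>a. D (chart_change d c p a))) (at (coord d p))"
proof -
  have "((\<lambda>z. (\<phi> \<circ> chart_inv c) (transition d c z)) has_derivative (\<lambda>a. D (chart_change d c p a)))
      (at (coord d p))"
    by (rule has_derivative_compose[OF transition_has_derivative[OF d c]])
      (use \<phi> transition_coord[OF d] in \<open>simp add: o_def\<close>)
  then show ?thesis
  proof (rule has_derivative_transform_within_open)
    show "open (coord d ` (chart_dom d \<inter> chart_dom c))"
      by (rule open_coord_image[OF charts_atD(1)[OF d] open_chart_dom[OF charts_atD(1)[OF c]]])
    show "coord d p \<in> coord d ` (chart_dom d \<inter> chart_dom c)"
      by (rule coord_in_overlap[OF d c])
  qed (auto simp: transition_def chart_inv_coord[OF charts_atD(1)[OF c]] chart_inv_coord[OF charts_atD(1)[OF d]])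
qed

lemma chart_change_compose:
  assumes c: "c \<in> charts_at M p" and d: "d \<in> charts_at M p" and e: "e \<in> charts_at M p"
  shows "chart_change d e p (chart_change c d p a) = chart_change c e p a"
proof -
  have "((coord e \<circ> chart_inv d) has_derivative chart_change d e p) (at (coord d p))"
    using transition_has_derivative[OF d e] by (simp add: transition_def)
  from chart_rep_change[OF d c this]
  have "(transition c e has_derivative (\<lambda>a. chart_change d e p (chart_change c d p a))) (at (coord c p))"
    by (simp add: transition_def)
  from has_derivative_unique[OF this transition_has_derivative[OF c e]] show ?thesis
    by (simp add: fun_eq_iff)
qed

lemma chart_change_self:
  assumes c: "c \<in> charts_at M p"
  shows "chart_change c c p a = a"
proof -
  have "(transition c c has_derivative (\<lambda>a. a)) (at (coord c p))"
    by (rule has_derivative_transform_within_open[OF has_derivative_ident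
          open_chart_image[OF charts_atD(1)[OF c]] coord_in_image[OF c]])
      (auto simp: transition_def chart_inv_coord[OF charts_atD(1)[OF c]])
  from has_derivative_unique[OF this transition_has_derivative[OF c c]] show ?thesis
    by (simp add: fun_eq_iff)
qed


subsection \<open>Tangent spaces\<close>

lemma tangent_spaceD:
  "v \<in> tangent_space M p \<Longrightarrow> c \<in> charts_at M p \<Longrightarrow> d \<in> charts_at M p \<Longrightarrow> v d = chart_change c d p (v c)"
  unfolding tangent_space_def chart_change_def by blast

lemma tangent_space_outside: "v \<in> tangent_space M p \<Longrightarrow> c \<notin> charts_at M p \<Longrightarrow> v c = 0"
  unfolding tangent_space_def by blast

lemma tangent_spaceI:
  assumes "\<And>c d. c \<in> charts_at M p \<Longrightarrow> d \<in> charts_at M p \<Longrightarrow> v d = chart_change c d p (v c)"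
    and "\<And>c. c \<notin> charts_at M p \<Longrightarrow> v c = 0"
  shows "v \<in> tangent_space M p"
  unfolding tangent_space_def mem_Collect_eq using assms[unfolded chart_change_def] by blast

lemma tangent_of_eq:
  "tangent_of M p c a d = (if d \<in> charts_at M p then chart_change c d p a else 0)"
  by (simp add: tangent_of_def chart_change_def)

lemma tangent_of_in: "c \<in> charts_at M p \<Longrightarrow> tangent_of M p c a \<in> tangent_space M p"
  by (rule tangent_spaceI) (simp_all add: tangent_of_eq chart_change_compose)

lemma tangent_of_self: "c \<in> charts_at M p \<Longrightarrow> tangent_of M p c a c = a"
  by (simp add: tangent_of_eq chart_change_self)

lemma tangent_eqI:
  assumes "v \<in> tangent_space M p" "w \<in> tangent_space M p" "c \<in> charts_at M p" "v c = w c"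
  shows "v = w"
proof
  fix d
  show "v d = w d"
    using assms tangent_spaceD[of _ p c d] tangent_space_outside[of _ p d]
    by (cases "d \<in> charts_at M p") metis+
qed

lemma tangent_of_coord:
  "v \<in> tangent_space M p \<Longrightarrow> c \<in> charts_at M p \<Longrightarrow> tangent_of M p c (v c) = v"
  by (rule tangent_eqI[where c = c]) (simp_all add: tangent_of_self tangent_of_in)

lemma tangent_space_zero: "0 \<in> tangent_space M p"
  by (rule tangent_spaceI) (simp_all add: linear_0[OF linear_chart_change])

lemma tangent_space_add:
  assumes v: "v \<in> tangent_space M p" and w: "w \<in> tangent_space M p"
  shows "v + w \<in> tangent_space M p"
proof (rule tangent_spaceI)
  fix c d
  assume "c \<in> charts_at M p" "d \<in> charts_at M p"
  then show "(v + w) d = chart_change c d p ((v + w) c)"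
    using tangent_spaceD[OF v, of c d] tangent_spaceD[OF w, of c d]
    by (simp add: linear_add[OF linear_chart_change])
qed (simp add: tangent_space_outside[OF v] tangent_space_outside[OF w])

lemma tangent_space_scaleR:
  assumes v: "v \<in> tangent_space M p"
  shows "r *\<^sub>R v \<in> tangent_space M p"
proof (rule tangent_spaceI)
  fix c d
  assume "c \<in> charts_at M p" "d \<in> charts_at M p"
  then show "(r *\<^sub>R v) d = chart_change c d p ((r *\<^sub>R v) c)"
    using tangent_spaceD[OF v, of c d]
    by (simp add: scaleR_fun_def linear_cmul[OF linear_chart_change])
qed (simp add: scaleR_fun_def tangent_space_outside[OF v])

lemma tangent_space_uminus: "v \<in> tangent_space M p \<Longrightarrow> - v \<in> tangent_space M p"
  using tangent_space_scaleR[of v p "-1"] by (simp del: scaleR_minus_left add: scaleR_minus1_left)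

lemma tangent_space_diff:
  "v \<in> tangent_space M p \<Longrightarrow> w \<in> tangent_space M p \<Longrightarrow> v - w \<in> tangent_space M p"
  using tangent_space_add[OF _ tangent_space_uminus] by (metis add_uminus_conv_diff)

lemma tangent_of_add:
  "c \<in> charts_at M p \<Longrightarrow> tangent_of M p c (a + b) = tangent_of M p c a + tangent_of M p c b"
  by (rule tangent_eqI[of _ _ _ c])
    (simp_all add: tangent_of_in tangent_space_add tangent_of_self)

lemma tangent_of_scaleR:
  "c \<in> charts_at M p \<Longrightarrow> tangent_of M p c (r *\<^sub>R a) = r *\<^sub>R tangent_of M p c a"
  by (rule tangent_eqI[of _ _ _ c])
    (simp_all add: tangent_of_in tangent_space_scaleR tangent_of_self, simp add: scaleR_fun_def tangent_of_self)


subsection \<open>Differentials\<close>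

text \<open>The differential is defined by a chosen chart. The chain rule for the coordinate change shows that
  every chart around the point gives the same value on a tangent vector.\<close>

lemma fun_diff_in_chart:
  fixes \<phi> :: "'a \<Rightarrow> 'v::real_normed_vector"
  assumes c: "c \<in> charts_at M p" and v: "v \<in> tangent_space M p"
    and \<phi>: "((\<phi> \<circ> chart_inv c) has_derivative D) (at (coord c p))"
  shows "fun_diff M \<phi> p v = D (v c)"
proof -
  let ?s = "some_chart M p"
  have s: "?s \<in> charts_at M p"
    by (rule some_chart_in)
  have "fun_diff M \<phi> p v = D (chart_change ?s c p (v ?s))"
    unfolding fun_diff_def Let_def frechet_derivative_at[OF chart_rep_change[OF c s \<phi>], symmetric] ..
  then show ?thesis
    using tangent_spaceD[OF v s c] by simp
qed

lemma fun_differentiableI: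
  assumes "c \<in> charts_at M p" "(\<phi> \<circ> chart_inv c) differentiable (at (coord c p))"
  shows "fun_differentiable M \<phi> p"
  using chart_rep_change[OF assms(1) _ assms(2)[unfolded frechet_derivative_works]]
  unfolding fun_differentiable_def differentiable_def by blast


subsection \<open>The metric\<close>

lemma
  assumes u: "u \<in> tangent_space M p" and v: "v \<in> tangent_space M p"
  shows rmetric_sym: "rmetric M p u v = rmetric M p v u"
    and rmetric_add_left:
      "w \<in> tangent_space M p \<Longrightarrow> rmetric M p (u + w) v = rmetric M p u v + rmetric M p w v"
    and rmetric_scaleR_left: "rmetric M p (r *\<^sub>R u) v = r * rmetric M p u v"
    and rmetric_pos: "u \<noteq> 0 \<Longrightarrow> rmetric M p u u > 0"
  using riemannian[unfolded riemannian_manifold_def, THEN conjunct2, THEN conjunct1, rule_format, OF u v]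
  by simp_all

lemma rmetric_zero_left: "v \<in> tangent_space M p \<Longrightarrow> rmetric M p 0 v = 0"
  using rmetric_scaleR_left[OF tangent_space_zero, of v p 0] by simp

lemma rmetric_diff_left:
  assumes "u \<in> tangent_space M p" "w \<in> tangent_space M p" "v \<in> tangent_space M p"
  shows "rmetric M p (u - w) v = rmetric M p u v - rmetric M p w v"
proof -
  have "rmetric M p (u - w + w) v = rmetric M p (u - w) v + rmetric M p w v"
    by (rule rmetric_add_left[OF tangent_space_diff]) (use assms in auto)
  then show ?thesis
    by simp
qed

lemma rmetric_eqI:
  assumes "u \<in> tangent_space M p" "w \<in> tangent_space M p"
    and "\<And>v. v \<in> tangent_space M p \<Longrightarrow> rmetric M p u v = rmetric M p w v"
  shows "u = w"
proof (rule ccontr)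
  assume "u \<noteq> w"
  then have "rmetric M p (u - w) (u - w) > 0"
    by (intro rmetric_pos[OF _ tangent_space_zero] tangent_space_diff assms) auto
  moreover have "rmetric M p (u - w) (u - w) = 0"
    using rmetric_diff_left[OF assms(1,2) tangent_space_diff[OF assms(1,2)]]
      assms(3)[OF tangent_space_diff[OF assms(1,2)]] by simp
  ultimately show False
    by simp
qed

lemma metric_in_chart_coord:
  assumes c: "c \<in> charts_at M p" and "v \<in> tangent_space M p" "w \<in> tangent_space M p"
  shows "metric_in_chart M c (coord c p) (v c) (w c) = rmetric M p v w"
  using assms by (simp add: metric_in_chart_def chart_inv_coord_at tangent_of_coord)

context
  fixes c :: "('a, 'e) chart" and z :: 'e
  assumes c: "c \<in> atlas M" and z: "z \<in> coord c ` chart_dom c"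
begin

lemma metric_in_chart_sym: "metric_in_chart M c z a b = metric_in_chart M c z b a"
  and metric_in_chart_add_left:
    "metric_in_chart M c z (a + a') b = metric_in_chart M c z a b + metric_in_chart M c z a' b"
  and metric_in_chart_scaleR_left: "metric_in_chart M c z (r *\<^sub>R a) b = r * metric_in_chart M c z a b"
  using rmetric_sym[OF tangent_of_in tangent_of_in] rmetric_add_left[OF tangent_of_in tangent_of_in tangent_of_in]
    rmetric_scaleR_left[OF tangent_of_in tangent_of_in] charts_at_chart_inv[OF c z]
  by (simp_all add: metric_in_chart_def tangent_of_add tangent_of_scaleR)

lemma metric_in_chart_add_right:
    "metric_in_chart M c z a (b + b') = metric_in_chart M c z a b + metric_in_chart M c z a b'"
  and metric_in_chart_scaleR_right: "metric_in_chart M c z a (r *\<^sub>R b) = r * metric_in_chart M c z a b"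
  using metric_in_chart_add_left[of b b' a] metric_in_chart_scaleR_left[of r b a]
  by (simp_all only: metric_in_chart_sym[of a])

lemma bilinear_metric_in_chart: "bilinear (metric_in_chart M c z)"
  unfolding bilinear_def
  by (intro conjI allI linearI)
    (simp_all add: metric_in_chart_add_left metric_in_chart_scaleR_left
      metric_in_chart_add_right metric_in_chart_scaleR_right)

lemma metric_in_chart_pos:
  assumes "a \<noteq> 0"
  shows "metric_in_chart M c z a a > 0"
proof -
  have "tangent_of M (chart_inv c z) c a \<noteq> 0"
    using assms tangent_of_self[OF charts_at_chart_inv[OF c z], of a] by auto
  then show ?thesis
    unfolding metric_in_chart_def
    by (rule rmetric_pos[OF tangent_of_in tangent_of_in, OF charts_at_chart_inv[OF c z] charts_at_chart_inv[OF c z]])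
qed

end

lemma smooth_on_metric_in_chart:
  assumes "c \<in> atlas M"
  shows "smooth_on (coord c ` chart_dom c) (\<lambda>z. metric_in_chart M c z a b)"
  using riemannian[unfolded riemannian_manifold_def, THEN conjunct2, THEN conjunct2] assms by blast

text \<open>As an operator on coordinate vectors, the metric makes finding a gradient a linear equation
  \<open>lower_index c z a = riesz D\<close> in a fixed Euclidean space, where \<open>D\<close> is the differential in the
  chart.\<close>

definition lower_index :: "('a, 'e) chart \<Rightarrow> 'e \<Rightarrow> 'e \<Rightarrow> 'e" where
  "lower_index c z a = (\<Sum>i\<in>Basis. metric_in_chart M c z a i *\<^sub>R i)"

lemma lower_index_inner:
  assumes "c \<in> atlas M" "z \<in> coord c ` chart_dom c"
  shows "lower_index c z a \<bullet> b = metric_in_chart M c z a b"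
proof -
  have lin: "linear (metric_in_chart M c z a)"
    using bilinear_metric_in_chart[OF assms] unfolding bilinear_def by blast
  show ?thesis
    using linear_euclidean_expansion[OF lin, of b]
    by (simp add: lower_index_def inner_sum_left inner_commute[of b] mult.commute)
qed

lemma linear_lower_index:
  assumes "c \<in> atlas M" "z \<in> coord c ` chart_dom c"
  shows "linear (lower_index c z)"
  by (rule linearI)
    (simp_all add: lower_index_def metric_in_chart_add_left[OF assms] metric_in_chart_scaleR_left[OF assms]
      scaleR_left_distrib sum.distrib scaleR_sum_right)

lemma inj_lower_index:
  assumes "c \<in> atlas M" "z \<in> coord c ` chart_dom c"
  shows "inj (lower_index c z)"
proof (rule linear_injective_0[OF linear_lower_index[OF assms], THEN iffD2], intro allI impI)
  fix a
  assume "lower_index c z a = 0"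
  then have "metric_in_chart M c z a a = 0"
    using lower_index_inner[OF assms, of a a] by simp
  then show "a = 0"
    using metric_in_chart_pos[OF assms, of a] by fastforce
qed

lemma metric_in_chart_eqI:
  assumes "c \<in> atlas M" "z \<in> coord c ` chart_dom c"
    and "\<And>b. metric_in_chart M c z a b = metric_in_chart M c z a' b"
  shows "a = a'"
proof -
  have "lower_index c z a = lower_index c z a'"
    by (simp add: lower_index_def assms(3))
  then show ?thesis
    using inj_lower_index[OF assms(1,2)] by (simp add: inj_eq)
qed

definition riesz :: "('e \<Rightarrow> real) \<Rightarrow> 'e" where
  "riesz l = (\<Sum>i\<in>Basis. l i *\<^sub>R i)"

lemma riesz_inner:
  assumes "linear l"
  shows "riesz l \<bullet> b = l b"
  using linear_euclidean_expansion[OF assms, of b]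
  by (simp add: riesz_def inner_sum_left inner_commute[of b] mult.commute)

lemma lower_index_eq_riesz_iff:
  assumes "c \<in> atlas M" "z \<in> coord c ` chart_dom c" "linear l"
  shows "lower_index c z a = riesz l \<longleftrightarrow> (\<forall>b. metric_in_chart M c z a b = l b)"
proof
  assume "lower_index c z a = riesz l"
  then show "\<forall>b. metric_in_chart M c z a b = l b"
    using lower_index_inner[OF assms(1,2)] riesz_inner[OF assms(3)] by metis
qed (simp add: lower_index_def riesz_def)

lemma metric_in_chart_represents:
  assumes "c \<in> atlas M" "z \<in> coord c ` chart_dom c" "linear l"
  obtains a where "\<And>b. metric_in_chart M c z a b = l b"
proof -
  have "surj (lower_index c z)"
    by (rule linear_injective_imp_surjective[OF linear_lower_index[OF assms(1,2)] inj_lower_index[OF assms(1,2)] refl])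
  then show ?thesis
    using that lower_index_eq_riesz_iff[OF assms] by (metis surjD)
qed


subsection \<open>Gradients\<close>

lemma gradient_eqI:
  assumes "w \<in> tangent_space M p"
    and "\<And>v. v \<in> tangent_space M p \<Longrightarrow> rmetric M p w v = fun_diff M \<phi> p v"
  shows "gradient M \<phi> p = w"
  unfolding gradient_def
proof (rule the_equality)
  fix w'
  assume "w' \<in> tangent_space M p \<and> (\<forall>v\<in>tangent_space M p. rmetric M p w' v = fun_diff M \<phi> p v)"
  then show "w' = w"
    using assms by (intro rmetric_eqI[of w' p w]) auto
qed (use assms in blast)

lemma
  assumes c: "c \<in> charts_at M p" and \<phi>: "((\<phi> \<circ> chart_inv c) has_derivative D) (at (coord c p))"
  shows gradient_in_tangent_space: "gradient M \<phi> p \<in> tangent_space M p"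
    and metric_in_chart_gradient: "metric_in_chart M c (coord c p) (gradient M \<phi> p c) b = D b"
proof -
  note z = charts_atD(1)[OF c] coord_in_image[OF c]
  obtain a where a: "\<And>b. metric_in_chart M c (coord c p) a b = D b"
    using metric_in_chart_represents[OF z has_derivative_linear[OF \<phi>]] by blast
  have "gradient M \<phi> p = tangent_of M p c a"
  proof (rule gradient_eqI)
    fix v
    assume v: "v \<in> tangent_space M p"
    have "rmetric M p (tangent_of M p c a) v = D (v c)"
      using metric_in_chart_coord[OF c tangent_of_in[OF c, of a] v] a tangent_of_self[OF c] by simp
    then show "rmetric M p (tangent_of M p c a) v = fun_diff M \<phi> p v"
      using fun_diff_in_chart[OF c v \<phi>] by simp
  qed (rule tangent_of_in[OF c])
  then show "gradient M \<phi> p \<in> tangent_space M p"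
    and "metric_in_chart M c (coord c p) (gradient M \<phi> p c) b = D b"
    using tangent_of_in[OF c] tangent_of_self[OF c] a by simp_all
qed

lemma rmetric_gradient:
  assumes c: "c \<in> charts_at M p" and \<phi>: "((\<phi> \<circ> chart_inv c) has_derivative D) (at (coord c p))"
    and v: "v \<in> tangent_space M p"
  shows "rmetric M p (gradient M \<phi> p) v = D (v c)"
  using metric_in_chart_gradient[OF c \<phi>]
    metric_in_chart_coord[OF c gradient_in_tangent_space[OF c \<phi>] v] by simp

end


section \<open>Second derivatives in charts\<close>

lemma has_derivative_slice_snd:
  assumes "(f has_derivative D) (at (z, w))"
  shows "((\<lambda>w. f (z, w)) has_derivative (\<lambda>b. D (0, b))) (at w)"
proof -
  have "((\<lambda>w. (z, w)) has_derivative (\<lambda>b. (0, b))) (at w)"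
    by (intro has_derivative_Pair has_derivative_const has_derivative_ident)
  from has_derivative_compose[OF this assms] show ?thesis .
qed

lemma has_derivative_slice_fst:
  assumes "(f has_derivative D) (at (z, w))"
  shows "((\<lambda>z. f (z, w)) has_derivative (\<lambda>a. D (a, 0))) (at z)"
proof -
  have "((\<lambda>z. (z, w)) has_derivative (\<lambda>a. (a, 0))) (at z)"
    by (intro has_derivative_Pair has_derivative_const has_derivative_ident)
  from has_derivative_compose[OF this assms] show ?thesis .
qed

lemma Ck_on_slice:
  fixes f :: "'e::euclidean_space \<times> 'f::euclidean_space \<Rightarrow> 'v::real_normed_vector"
  assumes "z \<in> U" "open V" "Ck_on k (U \<times> V) f"
  shows "Ck_on k V (\<lambda>w. f (z, w))"
  using assms(3)
proof (induction k arbitrary: f)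
  case 0
  have "continuous_on V (\<lambda>w. (z, w))"
    by (intro continuous_intros)
  from continuous_on_compose2[OF _ this, of "U \<times> V" f] show ?case
    using 0 assms(1) by auto
next
  case (Suc k)
  have d: "((\<lambda>w. f (z, w)) has_derivative (\<lambda>b. frechet_derivative f (at (z, w)) (0, b))) (at w)"
    if "w \<in> V" for w
    using Suc.prems assms(1) that frechet_derivative_works by (intro has_derivative_slice_snd) auto
  have "Ck_on k V (\<lambda>w. frechet_derivative (\<lambda>w. f (z, w)) (at w) v)" for v
  proof (rule Ck_on_cong[OF assms(2)])
    show "Ck_on k V (\<lambda>w. frechet_derivative f (at (z, w)) (0, v))"
      by (rule Suc.IH) (use Suc.prems in simp)
    show "frechet_derivative f (at (z, w)) (0, v) = frechet_derivative (\<lambda>w. f (z, w)) (at w) v"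
      if "w \<in> V" for w
      by (simp only: frechet_derivative_at[OF d[OF that], symmetric])
  qed
  then show ?case
    using d by (auto simp: differentiable_def)
qed

lemma smooth_on_slice:
  fixes f :: "'e::euclidean_space \<times> 'f::euclidean_space \<Rightarrow> 'v::real_normed_vector"
  shows "z \<in> U \<Longrightarrow> open V \<Longrightarrow> smooth_on (U \<times> V) f \<Longrightarrow> smooth_on V (\<lambda>w. f (z, w))"
  unfolding smooth_on_def by (blast intro: Ck_on_slice)

lemma second_derivative_has_derivative:
  assumes "smooth_on S f" "x \<in> S"
  shows "((\<lambda>y. frechet_derivative f (at y) v) has_derivative (\<lambda>u. second_derivative f x u v)) (at x)"
  unfolding second_derivative_def
  by (rule smooth_on_imp_has_derivative[OF smooth_on_frechet_derivative[OF assms(1)] assms(2)])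

lemma bilinear_second_derivative:
  assumes S: "open S" "x \<in> S" and f: "smooth_on S f"
  shows "bilinear (second_derivative f x)"
proof -
  note d = second_derivative_has_derivative[OF f S(2)]
  have lin: "linear (frechet_derivative f (at y))" if "y \<in> S" for y
    using linear_frechet_derivative[OF smooth_on_imp_differentiable[OF f that]] .
  have "second_derivative f x u (v + w) = second_derivative f x u v + second_derivative f x u w" for u v w
  proof -
    have "((\<lambda>y. frechet_derivative f (at y) (v + w)) has_derivative
        (\<lambda>u. second_derivative f x u v + second_derivative f x u w)) (at x)"
      by (rule has_derivative_transform_within_open[OF has_derivative_add[OF d d] S])
        (simp add: linear_add[OF lin])
    from has_derivative_unique[OF this d] show ?thesis
      by (simp add: fun_eq_iff)
  qed
  moreover have "second_derivative f x u (r *\<^sub>R v) = r *\<^sub>R second_derivative f x u v" for u v r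
  proof -
    have "((\<lambda>y. frechet_derivative f (at y) (r *\<^sub>R v)) has_derivative
        (\<lambda>u. r *\<^sub>R second_derivative f x u v)) (at x)"
      by (rule has_derivative_transform_within_open[OF has_derivative_scaleR_right[OF d] S])
        (simp add: linear_cmul[OF lin])
    from has_derivative_unique[OF this d] show ?thesis
      by (simp add: fun_eq_iff)
  qed
  ultimately show ?thesis
    unfolding bilinear_def using has_derivative_linear[OF d] by (auto intro: linearI)
qed

lemma second_derivative_slice:
  fixes f :: "'e::euclidean_space \<times> 'f::euclidean_space \<Rightarrow> 'v::real_normed_vector"
  assumes UV: "open V" "z \<in> U" "w \<in> V" and f: "smooth_on (U \<times> V) f"
  shows "second_derivative (\<lambda>w. f (z, w)) w a b = second_derivative f (z, w) (0, a) (0, b)"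
proof -
  have d: "frechet_derivative (\<lambda>w. f (z, w)) (at w') b = frechet_derivative f (at (z, w')) (0, b)"
    if "w' \<in> V" for w'
  proof -
    have "(f has_derivative frechet_derivative f (at (z, w'))) (at (z, w'))"
      by (rule smooth_on_imp_has_derivative[OF f]) (use that UV in simp)
    from frechet_derivative_at[OF has_derivative_slice_snd[OF this]] show ?thesis
      by (simp add: fun_eq_iff)
  qed
  have "((\<lambda>w'. frechet_derivative f (at (z, w')) (0, b)) has_derivative
      (\<lambda>a. second_derivative f (z, w) (0, a) (0, b))) (at w)"
    by (rule has_derivative_slice_snd[OF second_derivative_has_derivative[OF f]]) (use UV in simp)
  then have "((\<lambda>w'. frechet_derivative (\<lambda>w. f (z, w)) (at w') b) has_derivative
      (\<lambda>a. second_derivative f (z, w) (0, a) (0, b))) (at w)"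
    by (rule has_derivative_transform_within_open[OF _ UV(1,3)]) (simp add: d)
  from frechet_derivative_at[OF this] show ?thesis
    by (simp add: second_derivative_def fun_eq_iff)
qed


subsection \<open>The Hessian at a critical point\<close>

context riemannian
begin

lemma christoffel_zero_right:
  assumes c: "c \<in> atlas M" and z: "z \<in> coord c ` chart_dom c"
  shows "christoffel M c z a 0 = 0"
proof -
  note zero = bilinear_lzero[OF bilinear_metric_in_chart[OF c]] bilinear_rzero[OF bilinear_metric_in_chart[OF c]]
  have const: "frechet_derivative (\<lambda>z. metric_in_chart M c z 0 e) (at z) v = 0"
    "frechet_derivative (\<lambda>z. metric_in_chart M c z e 0) (at z) v = 0" for e v
  proof -
    have "((\<lambda>z. metric_in_chart M c z 0 e) has_derivative (\<lambda>_. 0)) (at z)"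
      "((\<lambda>z. metric_in_chart M c z e 0) has_derivative (\<lambda>_. 0)) (at z)"
      by (rule has_derivative_transform_within_open[OF has_derivative_const[of 0] open_chart_image[OF c] z],
          simp add: zero)+
    then show "frechet_derivative (\<lambda>z. metric_in_chart M c z 0 e) (at z) v = 0"
      "frechet_derivative (\<lambda>z. metric_in_chart M c z e 0) (at z) v = 0"
      using frechet_derivative_at by metis+
  qed
  have lin0: "frechet_derivative (\<lambda>z. metric_in_chart M c z a e) (at z) 0 = 0" for e
    by (rule linear_0[OF linear_frechet_derivative[OF
            smooth_on_imp_differentiable[OF smooth_on_metric_in_chart[OF c] z]]])
  show ?thesis
    unfolding christoffel_def
    by (rule the_equality)
      (auto simp: const lin0 zero[OF z] intro!: metric_in_chart_eqI[OF c z])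
qed

text \<open>In a chart, the gradient solves a linear equation whose coefficients are the metric and whose
  right-hand side is the differential. Where the gradient vanishes, the derivative of the metric
  drops out, and so does the Christoffel term of the Hessian.\<close>

lemma gradient_has_derivative_at_critical_point:
  assumes c: "c \<in> charts_at M p" and h: "smooth_fun (atlas M) h" and crit: "gradient M h p = 0"
  shows "\<exists>A'. ((\<lambda>z. gradient M h (chart_inv c z) c) has_derivative A') (at (coord c p)) \<and>
    (\<forall>a b. metric_in_chart M c (coord c p) (A' a) b =
       second_derivative (h \<circ> chart_inv c) (coord c p) a b) \<and>
    (\<forall>v. hessian M h p v c = A' (v c))"
proof -
  let ?U = "coord c ` chart_dom c" and ?z0 = "coord c p" and ?h = "h \<circ> chart_inv c"
  note c' = charts_atD(1)[OF c]
  note z0 = coord_in_image[OF c]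
  note U = open_chart_image[OF c'] z0
  have hs: "smooth_on ?U ?h"
    using h c' unfolding smooth_fun_def by blast
  define A where "A = (\<lambda>z. gradient M h (chart_inv c z) c)"
  have eq: "lower_index c z (A z) = riesz (frechet_derivative ?h (at z))" if z: "z \<in> ?U" for z
  proof -
    have "(?h has_derivative frechet_derivative ?h (at z)) (at (coord c (chart_inv c z)))"
      using smooth_on_imp_has_derivative[OF hs z] coord_chart_inv[OF c' z] by simp
    from metric_in_chart_gradient[OF charts_at_chart_inv[OF c' z] this]
    have "metric_in_chart M c z (A z) b = frechet_derivative ?h (at z) b" for b
      by (simp add: A_def coord_chart_inv[OF c' z])
    then show ?thesis
      using lower_index_eq_riesz_iff[OF c' z linear_frechet_derivative[OF smooth_on_imp_differentiable[OF hs z]]]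
      by blast
  qed
  have A0: "A ?z0 = 0"
    by (simp add: A_def chart_inv_coord_at[OF c] crit)
  have r: "((\<lambda>z. riesz (frechet_derivative ?h (at z))) has_derivative
      (\<lambda>a. riesz (second_derivative ?h ?z0 a))) (at ?z0)"
    unfolding riesz_def
    by (intro has_derivative_sum has_derivative_scaleR_left second_derivative_has_derivative[OF hs z0])
  have cont: "((\<lambda>z. lower_index c z a) \<longlongrightarrow> lower_index c ?z0 a) (at ?z0)" for a
  proof -
    have "((\<lambda>z. metric_in_chart M c z a i) \<longlongrightarrow> metric_in_chart M c ?z0 a i) (at ?z0)" for i
      using smooth_on_imp_continuous_on[OF smooth_on_metric_in_chart[OF c', of a i]]
      unfolding continuous_on_eq_continuous_at[OF U(1)] continuous_at using U(2) by blast
    then show ?thesis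
      unfolding lower_index_def by (intro tendsto_intros)
  qed
  obtain A' where A': "(A has_derivative A') (at ?z0)"
      "\<And>a. lower_index c ?z0 (A' a) = riesz (second_derivative ?h ?z0 a)"
    using has_derivative_linear_equation_at_zero[OF U linear_lower_index[OF c'] eq A0
        inj_lower_index[OF c' z0] r cont] by blast
  have lin: "linear (second_derivative ?h ?z0 a)" for a
    using bilinear_second_derivative[OF U hs] unfolding bilinear_def by blast
  have met: "metric_in_chart M c ?z0 (A' a) b = second_derivative ?h ?z0 a b" for a b
    using A'(2) lower_index_eq_riesz_iff[OF c' z0 lin] by blast
  have "hessian M h p v c = A' (v c)" for v
    using c crit frechet_derivative_at[OF A'(1)]
    by (simp add: hessian_def covariant_derivative_def A_def christoffel_zero_right[OF c' z0])
  then show ?thesis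
    using A'(1) met unfolding A_def by blast
qed

text \<open>In general the coordinate derivative of a vector field does not transform like a tangent vector,
  because the derivative also hits the coordinate change. Here that extra term is multiplied by the
  vanishing gradient.\<close>

lemma hessian_in_tangent_space:
  assumes h: "smooth_fun (atlas M) h" and crit: "gradient M h p = 0"
    and v: "v \<in> tangent_space M p"
  shows "hessian M h p v \<in> tangent_space M p"
proof (rule tangent_spaceI)
  fix c d
  assume c: "c \<in> charts_at M p" and d: "d \<in> charts_at M p"
  note c' = charts_atD(1)[OF c] and d' = charts_atD(1)[OF d]
  let ?z0 = "coord c p" and ?O = "coord c ` (chart_dom c \<inter> chart_dom d)"
  let ?A = "\<lambda>c z. gradient M h (chart_inv c z) c"
  obtain A' where A': "(?A c has_derivative A') (at ?z0)"
    and hess_c: "\<And>v. hessian M h p v c = A' (v c)"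
    using gradient_has_derivative_at_critical_point[OF c h crit] by blast
  obtain B' where B': "(?A d has_derivative B') (at (coord d p))"
    and hess_d: "\<And>v. hessian M h p v d = B' (v d)"
    using gradient_has_derivative_at_critical_point[OF d h crit] by blast
  have \<O>: "open ?O" "?z0 \<in> ?O"
    using open_coord_image[OF c' open_chart_dom[OF d']] coord_in_overlap[OF c d] by auto
  have A0: "?A c ?z0 = 0"
    by (simp add: chart_inv_coord_at[OF c] crit)
  have lhs: "((\<lambda>z. ?A d (transition c d z)) has_derivative (\<lambda>a. B' (chart_change c d p a))) (at ?z0)"
    by (rule has_derivative_compose[OF transition_has_derivative[OF c d]])
      (use B' transition_coord[OF c] in simp)
  have smooth: "((\<lambda>z. frechet_derivative (transition c d) (at z) i) has_derivative
      (\<lambda>a. second_derivative (transition c d) ?z0 a i)) (at ?z0)" for i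
    by (rule second_derivative_has_derivative[OF smooth_on_transition[OF c' d'] \<O>(2)])
  have "((\<lambda>z. \<Sum>i\<in>Basis. (?A c z \<bullet> i) *\<^sub>R frechet_derivative (transition c d) (at z) i) has_derivative
      (\<lambda>a. \<Sum>i\<in>Basis. (?A c ?z0 \<bullet> i) *\<^sub>R second_derivative (transition c d) ?z0 a i
        + (A' a \<bullet> i) *\<^sub>R frechet_derivative (transition c d) (at ?z0) i)) (at ?z0)"
    by (intro has_derivative_sum has_derivative_scaleR has_derivative_inner_left A' smooth)
  then have deriv: "((\<lambda>z. \<Sum>i\<in>Basis. (?A c z \<bullet> i) *\<^sub>R frechet_derivative (transition c d) (at z) i) has_derivative
      (\<lambda>a. \<Sum>i\<in>Basis. (A' a \<bullet> i) *\<^sub>R chart_change c d p i)) (at ?z0)"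
    by (simp add: A0 chart_change_def)
  have eq: "(\<Sum>i\<in>Basis. (?A c z \<bullet> i) *\<^sub>R frechet_derivative (transition c d) (at z) i)
      = ?A d (transition c d z)" if z: "z \<in> ?O" for z
  proof -
    let ?q = "chart_inv c z"
    have zU: "z \<in> coord c ` chart_dom c" and q: "?q \<in> chart_dom d"
      using z in_coord_image_iff[OF c'] by blast+
    have cq: "c \<in> charts_at M ?q" and dq: "d \<in> charts_at M ?q"
      using charts_at_chart_inv[OF c' zU] q d' by (auto simp: charts_at_def)
    have lin: "linear (frechet_derivative (transition c d) (at z))"
      using linear_chart_change[OF cq dq] by (simp add: chart_change_def coord_chart_inv[OF c' zU])
    have "(\<Sum>i\<in>Basis. (?A c z \<bullet> i) *\<^sub>R frechet_derivative (transition c d) (at z) i)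
        = frechet_derivative (transition c d) (at z) (?A c z)"
      by (rule linear_euclidean_expansion[OF lin])
    also have "\<dots> = chart_change c d ?q (?A c z)"
      by (simp add: chart_change_def coord_chart_inv[OF c' zU])
    also have "\<dots> = gradient M h ?q d"
    proof -
      have "(h \<circ> chart_inv c) differentiable (at (coord c ?q))"
        using h c' smooth_on_imp_differentiable[of _ "h \<circ> chart_inv c"] coord_in_image[OF cq]
        unfolding smooth_fun_def by blast
      then have "gradient M h ?q \<in> tangent_space M ?q"
        using gradient_in_tangent_space[OF cq] frechet_derivative_works by blast
      from tangent_spaceD[OF this cq dq] show ?thesis
        by simp
    qed
    also have "\<dots> = ?A d (transition c d z)"
      using chart_inv_coord[OF d' q] by (simp add: transition_def)
    finally show ?thesis .
  qed
  have "((\<lambda>z. ?A d (transition c d z)) has_derivative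
      (\<lambda>a. \<Sum>i\<in>Basis. (A' a \<bullet> i) *\<^sub>R chart_change c d p i)) (at ?z0)"
    by (rule has_derivative_transform_within_open[OF deriv \<O>]) (rule eq)
  from has_derivative_unique[OF lhs this]
  have "B' (chart_change c d p (v c)) = (\<Sum>i\<in>Basis. (A' (v c) \<bullet> i) *\<^sub>R chart_change c d p i)"
    by (simp add: fun_eq_iff)
  also have "\<dots> = chart_change c d p (A' (v c))"
    by (rule linear_euclidean_expansion[OF linear_chart_change[OF c d]])
  finally show "hessian M h p v d = chart_change c d p (hessian M h p v c)"
    unfolding hess_c hess_d tangent_spaceD[OF v c d] .
qed (simp add: hessian_def covariant_derivative_def)

lemma rmetric_hessian_at_critical_point:
  assumes c: "c \<in> charts_at M p" and h: "smooth_fun (atlas M) h" and crit: "gradient M h p = 0"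
    and v: "v \<in> tangent_space M p" and w: "w \<in> tangent_space M p"
  shows "rmetric M p (hessian M h p v) w =
    second_derivative (h \<circ> chart_inv c) (coord c p) (v c) (w c)"
proof -
  obtain A' where
    "\<And>a b. metric_in_chart M c (coord c p) (A' a) b =
       second_derivative (h \<circ> chart_inv c) (coord c p) a b"
    and "\<And>v. hessian M h p v c = A' (v c)"
    using gradient_has_derivative_at_critical_point[OF c h crit] by blast
  then show ?thesis
    using metric_in_chart_coord[OF c hessian_in_tangent_space[OF h crit v] w] by simp
qed

text \<open>In a chart the Hessian is a linear endomorphism of the coordinate space. It is injective because
  the second derivative is nondegenerate, hence bijective by finite dimension.\<close>

lemma hessian_bij_betw:
  assumes c: "c \<in> charts_at M p" and h: "smooth_fun (atlas M) h" and crit: "gradient M h p = 0"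
    and nondeg: "\<And>a. (\<And>b. second_derivative (h \<circ> chart_inv c) (coord c p) a b = 0) \<Longrightarrow> a = 0"
  shows "bij_betw (hessian M h p) (tangent_space M p) (tangent_space M p)"
proof -
  obtain A' where A': "((\<lambda>z. gradient M h (chart_inv c z) c) has_derivative A') (at (coord c p))"
    and met: "\<And>a b. metric_in_chart M c (coord c p) (A' a) b =
       second_derivative (h \<circ> chart_inv c) (coord c p) a b"
    and hess: "\<And>v. hessian M h p v c = A' (v c)"
    using gradient_has_derivative_at_critical_point[OF c h crit] by blast
  have lin: "linear A'"
    using A' by (rule has_derivative_linear)
  have inj: "inj A'"
  proof (rule linear_injective_0[OF lin, THEN iffD2], intro allI impI)
    fix a
    assume "A' a = 0"
    then have "second_derivative (h \<circ> chart_inv c) (coord c p) a b = 0" for b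
      using met[of a b] bilinear_lzero[OF bilinear_metric_in_chart[OF charts_atD(1)[OF c] coord_in_image[OF c]]]
      by simp
    then show "a = 0"
      by (rule nondeg)
  qed
  have surj: "surj A'"
    by (rule linear_injective_imp_surjective[OF lin inj refl])
  note hT = hessian_in_tangent_space[OF h crit]
  show ?thesis
    unfolding bij_betw_def
  proof
    show "inj_on (hessian M h p) (tangent_space M p)"
    proof (rule inj_onI)
      fix v w
      assume v: "v \<in> tangent_space M p" and w: "w \<in> tangent_space M p" and "hessian M h p v = hessian M h p w"
      then have "A' (v c) = A' (w c)"
        by (metis hess)
      then show "v = w"
        using inj by (intro tangent_eqI[OF v w c]) (simp add: inj_eq)
    qed
    show "hessian M h p ` tangent_space M p = tangent_space M p"
    proof (intro equalityI image_subsetI subsetI)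
      fix w
      assume w: "w \<in> tangent_space M p"
      obtain a where a: "w c = A' a"
        using surj by (metis surjD)
      have "w = hessian M h p (tangent_of M p c a)"
        by (rule tangent_eqI[OF w hT[OF tangent_of_in[OF c]] c]) (simp add: hess a tangent_of_self[OF c])
      then show "w \<in> hessian M h p ` tangent_space M p"
        using tangent_of_in[OF c] by blast
    qed (rule hT)
  qed
qed

end


subsection \<open>Cross derivatives\<close>

text \<open>All gradients below are taken at the same point, where the metric is a fixed inner product.
  So lowering the index commutes with differentiation in the parameter.\<close>

lemma (in riemannian) cross_derivative:
  fixes N :: "('c::{t2_space, second_countable_topology}, 'g::euclidean_space) rmanifold"
    and \<psi> :: "'c \<Rightarrow> 'a \<Rightarrow> real"
  assumes N: "riemannian N"
    and c: "c \<in> charts_at N q" and d: "d \<in> charts_at M p"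
    and diff: "\<And>z. z \<in> coord c ` chart_dom c \<Longrightarrow>
      (\<psi> (chart_inv c z) \<circ> chart_inv d has_derivative D z) (at (coord d p))"
    and K: "\<And>b. ((\<lambda>z. D z b) has_derivative (\<lambda>a. K a b)) (at (coord c q))"
    and v: "v \<in> tangent_space N q"
  shows "(\<lambda>e. fun_diff N (\<lambda>q'. gradient M (\<psi> q') p e) q v) \<in> tangent_space M p"
    and "w \<in> tangent_space M p \<Longrightarrow> rmetric M p (\<lambda>e. fun_diff N (\<lambda>q'. gradient M (\<psi> q') p e) q v) w = K (v c) (w d)"
proof -
  interpret N: riemannian N
    by (rule N)
  let ?X = "\<lambda>e. fun_diff N (\<lambda>q'. gradient M (\<psi> q') p e) q v"
  let ?S = "coord c ` chart_dom c" and ?z0 = "coord c q" and ?w0 = "coord d p"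
  note d' = charts_atD(1)[OF d] coord_in_image[OF d]
  note S = N.open_chart_image[OF N.charts_atD(1)[OF c]] N.coord_in_image[OF c]
  define X where "X = (\<lambda>z. gradient M (\<psi> (chart_inv c z)) p)"
  have XT: "X z \<in> tangent_space M p" if "z \<in> ?S" for z
    unfolding X_def by (rule gradient_in_tangent_space[OF d diff[OF that]])
  have linD: "linear (D z)" if "z \<in> ?S" for z
    by (rule has_derivative_linear[OF diff[OF that]])
  obtain J where J: "linear J" "\<And>a. J (lower_index d ?w0 a) = a" "\<And>a. lower_index d ?w0 (J a) = a"
    using linear_injective_isomorphism[OF linear_lower_index[OF d'] inj_lower_index[OF d']] by auto
  have Xd: "J (riesz (D z)) = X z d" if z: "z \<in> ?S" for z
  proof -
    have "lower_index d ?w0 (X z d) = riesz (D z)"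
      unfolding lower_index_eq_riesz_iff[OF d' linD[OF z]] X_def
      using metric_in_chart_gradient[OF d diff[OF z]] by blast
    then show ?thesis
      using J(2)[of "X z d"] by simp
  qed
  have deriv_d: "((\<lambda>z. X z d) has_derivative (\<lambda>a. J (riesz (K a)))) (at ?z0)"
  proof -
    have "((\<lambda>z. riesz (D z)) has_derivative (\<lambda>a. riesz (K a))) (at ?z0)"
      unfolding riesz_def by (intro has_derivative_sum has_derivative_scaleR_left K)
    then have "((\<lambda>z. J (riesz (D z))) has_derivative (\<lambda>a. J (riesz (K a)))) (at ?z0)"
      using bounded_linear.has_derivative[OF J(1)[unfolded linear_conv_bounded_linear]] by blast
    then show ?thesis
      by (rule has_derivative_transform_within_open[OF _ S]) (simp add: Xd)
  qed
  have deriv: "((\<lambda>z. X z e) has_derivative (\<lambda>a. chart_change d e p (J (riesz (K a))))) (at ?z0)"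
    if e: "e \<in> charts_at M p" for e
  proof -
    have "((\<lambda>z. chart_change d e p (X z d)) has_derivative (\<lambda>a. chart_change d e p (J (riesz (K a))))) (at ?z0)"
      using bounded_linear.has_derivative[OF linear_chart_change[OF d e, unfolded linear_conv_bounded_linear] deriv_d] .
    then show ?thesis
      by (rule has_derivative_transform_within_open[OF _ S]) (simp add: tangent_spaceD[OF XT d e])
  qed
  have in_e: "?X e = chart_change d e p (J (riesz (K (v c))))" if e: "e \<in> charts_at M p" for e
    by (rule N.fun_diff_in_chart[OF c v]) (use deriv[OF e] in \<open>simp add: o_def X_def\<close>)
  have out: "?X e = 0" if e: "e \<notin> charts_at M p" for e
  proof -
    have "((\<lambda>z. X z e) has_derivative (\<lambda>_. 0)) (at ?z0)"
      by (rule has_derivative_transform_within_open[OF has_derivative_const[of 0] S])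
        (simp add: tangent_space_outside[OF XT e])
    then show ?thesis
      using N.fun_diff_in_chart[OF c v, of "\<lambda>q'. gradient M (\<psi> q') p e" "\<lambda>_. 0"]
      by (simp add: o_def X_def)
  qed
  have Xeq: "?X = tangent_of M p d (J (riesz (K (v c))))"
    using in_e out by (auto simp: tangent_of_eq)
  then show XT': "?X \<in> tangent_space M p"
    using tangent_of_in[OF d] by simp
  assume w: "w \<in> tangent_space M p"
  have linK: "linear (K a)" for a
  proof (rule linearI)
    fix b b' :: 'e and r :: real
    have "((\<lambda>z. D z (b + b')) has_derivative (\<lambda>a. K a b + K a b')) (at ?z0)"
      by (rule has_derivative_transform_within_open[OF has_derivative_add[OF K K] S])
        (simp add: linear_add[OF linD])
    from has_derivative_unique[OF K this] show "K a (b + b') = K a b + K a b'"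
      by (simp add: fun_eq_iff)
    have "((\<lambda>z. D z (r *\<^sub>R b)) has_derivative (\<lambda>a. r *\<^sub>R K a b)) (at ?z0)"
      by (rule has_derivative_transform_within_open[OF has_derivative_scaleR_right[OF K] S])
        (simp add: linear_cmul[OF linD])
    from has_derivative_unique[OF K this] show "K a (r *\<^sub>R b) = r *\<^sub>R K a b"
      by (simp add: fun_eq_iff)
  qed
  have "rmetric M p ?X w = metric_in_chart M d ?w0 (J (riesz (K (v c)))) (w d)"
    unfolding Xeq using metric_in_chart_coord[OF d tangent_of_in[OF d] w]
    by (simp add: tangent_of_self[OF d])
  also have "\<dots> = K (v c) (w d)"
    using lower_index_eq_riesz_iff[OF d' linK] J(3) by blast
  finally show "rmetric M p ?X w = K (v c) (w d)" .
qed


section \<open>Geodesics and strong convexity\<close>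

context riemannian
begin

subsection \<open>The Koszul formula\<close>

definition lower_index_deriv :: "('a, 'e) chart \<Rightarrow> 'e \<Rightarrow> 'e \<Rightarrow> 'e \<Rightarrow> 'e" where
  "lower_index_deriv c z a b = frechet_derivative (\<lambda>y. lower_index c y b) (at z) a"

context
  fixes c :: "('a, 'e) chart" and z :: 'e
  assumes c: "c \<in> atlas M" and z: "z \<in> coord c ` chart_dom c"
begin

lemma lower_index_has_derivative:
  "((\<lambda>y. lower_index c y b) has_derivative (\<lambda>a. lower_index_deriv c z a b)) (at z)"
proof -
  have "(\<lambda>y. lower_index c y b) differentiable (at z)"
    unfolding lower_index_def
    by (intro differentiable_sum differentiable_scaleR differentiable_const finite_Basis ballI
        smooth_on_imp_differentiable[OF smooth_on_metric_in_chart[OF c] z])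
  then show ?thesis
    by (simp add: lower_index_deriv_def frechet_derivative_works)
qed

lemma frechet_derivative_metric_in_chart:
  "frechet_derivative (\<lambda>y. metric_in_chart M c y b e) (at z) a = lower_index_deriv c z a b \<bullet> e"
proof -
  have "((\<lambda>y. metric_in_chart M c y b e) has_derivative (\<lambda>a. lower_index_deriv c z a b \<bullet> e)) (at z)"
    by (rule has_derivative_transform_within_open[OF
          has_derivative_inner_left[OF lower_index_has_derivative] open_chart_image[OF c] z])
      (simp add: lower_index_inner[OF c])
  from frechet_derivative_at[OF this] show ?thesis
    by (simp add: fun_eq_iff)
qed

lemma lower_index_deriv_expansion:
  "(\<Sum>i\<in>Basis. (b \<bullet> i) *\<^sub>R lower_index_deriv c z a i) = lower_index_deriv c z a b"
proof -
  have "((\<lambda>y. \<Sum>i\<in>Basis. (b \<bullet> i) *\<^sub>R lower_index c y i) has_derivative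
      (\<lambda>a. \<Sum>i\<in>Basis. (b \<bullet> i) *\<^sub>R lower_index_deriv c z a i)) (at z)"
    by (intro has_derivative_sum has_derivative_scaleR_right lower_index_has_derivative)
  then have "((\<lambda>y. lower_index c y b) has_derivative
      (\<lambda>a. \<Sum>i\<in>Basis. (b \<bullet> i) *\<^sub>R lower_index_deriv c z a i)) (at z)"
    by (rule has_derivative_transform_within_open[OF _ open_chart_image[OF c] z])
      (simp add: linear_euclidean_expansion[OF linear_lower_index[OF c]])
  from has_derivative_unique[OF this lower_index_has_derivative] show ?thesis
    by (simp add: fun_eq_iff)
qed

text \<open>The definite description in the definition of the Christoffel symbols is justified: the right-hand
  side is linear in \<open>e\<close>, so it is represented by a unique vector.\<close>

lemma koszul:
  "2 * metric_in_chart M c z (christoffel M c z a b) e =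
     lower_index_deriv c z a b \<bullet> e + lower_index_deriv c z b a \<bullet> e - lower_index_deriv c z e a \<bullet> b"
proof -
  let ?l = "\<lambda>e. (lower_index_deriv c z a b \<bullet> e + lower_index_deriv c z b a \<bullet> e
      - lower_index_deriv c z e a \<bullet> b) / 2"
  have "linear (\<lambda>e. lower_index_deriv c z e a)"
    by (rule has_derivative_linear[OF lower_index_has_derivative])
  from linear_add[OF this] linear_cmul[OF this] have "linear ?l"
    by (intro linearI) (simp_all add: inner_add_left inner_add_right field_simps)
  then obtain w where w: "\<And>e. metric_in_chart M c z w e = ?l e"
    using metric_in_chart_represents[OF c z] by blast
  have "christoffel M c z a b = w"
    unfolding christoffel_def frechet_derivative_metric_in_chart
  proof (rule the_equality)
    fix w'
    assume w': "\<forall>e. 2 * metric_in_chart M c z w' e =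
      lower_index_deriv c z a b \<bullet> e + lower_index_deriv c z b a \<bullet> e - lower_index_deriv c z e a \<bullet> b"
    show "w' = w"
    proof (rule metric_in_chart_eqI[OF c z])
      fix e
      show "metric_in_chart M c z w' e = metric_in_chart M c z w e"
        using w'[rule_format, of e] by (simp add: w)
    qed
  qed (simp add: w)
  then show ?thesis
    by (simp add: w)
qed

end


subsection \<open>Speed of a geodesic\<close>

context
  fixes \<gamma> :: "real \<Rightarrow> 'a"
  assumes \<gamma>: "geodesic M \<gamma>"
begin

lemma geodesic_has_vector_derivative:
  assumes "t \<in> {0..1}" "c \<in> charts_at M (\<gamma> t)"
  shows "((\<lambda>s. coord c (\<gamma> s)) has_vector_derivative velocity M \<gamma> t c) (at t within {0..1})"
  using \<gamma> assms unfolding geodesic_def velocity_def by (simp add: vector_derivative_works)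

lemma velocity_in_tangent_space:
  assumes t: "t \<in> {0..1}"
  shows "velocity M \<gamma> t \<in> tangent_space M (\<gamma> t)"
proof (rule tangent_spaceI)
  fix c d
  assume c: "c \<in> charts_at M (\<gamma> t)" and d: "d \<in> charts_at M (\<gamma> t)"
  have "continuous_on {0..1} \<gamma>"
    using \<gamma> by (simp add: geodesic_def)
  then obtain N where N: "open N" "t \<in> N" "\<And>s. s \<in> {0..1} \<Longrightarrow> s \<in> N \<Longrightarrow> \<gamma> s \<in> chart_dom c"
    unfolding continuous_on_topological
    using t open_chart_dom[OF charts_atD(1)[OF c]] charts_atD(2)[OF c] by metis
  then obtain r where r: "r > 0" "\<And>s. dist s t < r \<Longrightarrow> s \<in> N"
    unfolding open_dist by blast
  have "((transition c d \<circ> (\<lambda>s. coord c (\<gamma> s))) has_vector_derivative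
      chart_change c d (\<gamma> t) (velocity M \<gamma> t c)) (at t within {0..1})"
    by (rule vector_derivative_diff_chain_within[OF geodesic_has_vector_derivative[OF t c]
          has_derivative_at_withinI[OF transition_has_derivative[OF c d]]])
  then have "((\<lambda>s. coord d (\<gamma> s)) has_vector_derivative
      chart_change c d (\<gamma> t) (velocity M \<gamma> t c)) (at t within {0..1})"
    by (rule has_vector_derivative_transform_within[OF _ r(1) t])
      (simp add: transition_def chart_inv_coord[OF charts_atD(1)[OF c]] r(2) N(3))
  then show "velocity M \<gamma> t d = chart_change c d (\<gamma> t) (velocity M \<gamma> t c)"
    using vector_derivative_unique_within_closed_interval[of 0 1 t "\<lambda>s. coord d (\<gamma> s)"]
      geodesic_has_vector_derivative[OF t d] t by (simp add: box_real)
qed (simp add: velocity_def)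

text \<open>By the Koszul formula the Christoffel term in the derivative of the squared speed cancels the
  derivative of the metric.\<close>

lemma geodesic_speed_constant:
  assumes c: "c \<in> atlas M" and T: "T \<le> 1" and dom: "\<And>t. t \<in> {0..T} \<Longrightarrow> \<gamma> t \<in> chart_dom c"
    and t: "t \<in> {0..T}"
  shows "metric_in_chart M c (coord c (\<gamma> t)) (velocity M \<gamma> t c) (velocity M \<gamma> t c) =
    metric_in_chart M c (coord c (\<gamma> 0)) (velocity M \<gamma> 0 c) (velocity M \<gamma> 0 c)"
proof -
  define \<zeta> where "\<zeta> = (\<lambda>t. coord c (\<gamma> t))"
  define v where "v = (\<lambda>t. velocity M \<gamma> t c)"
  define E where "E = (\<lambda>t. \<Sum>i\<in>Basis. (v t \<bullet> i) * (lower_index c (\<zeta> t) i \<bullet> v t))"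
  have z: "\<zeta> t \<in> coord c ` chart_dom c" if "t \<in> {0..T}" for t
    using dom[OF that] by (simp add: \<zeta>_def)
  have expand: "(\<Sum>i\<in>Basis. (a \<bullet> i) * (lower_index c (\<zeta> t) i \<bullet> b)) =
      metric_in_chart M c (\<zeta> t) a b" if "t \<in> {0..T}" for t a b
    using arg_cong[OF linear_euclidean_expansion[OF linear_lower_index[OF c z[OF that]], of a], of "\<lambda>x. x \<bullet> b"]
    by (simp add: inner_sum_left lower_index_inner[OF c z[OF that]])
  have "(E has_real_derivative 0) (at t within {0..T})" if t: "t \<in> {0..T}" for t
  proof -
    let ?z = "\<zeta> t" and ?v = "v t"
    define w where "w = christoffel M c ?z ?v ?v"
    have t1: "t \<in> {0..1}" and sub: "{0..T} \<subseteq> {0..1}"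
      using t T by auto
    have cc: "c \<in> charts_at M (\<gamma> t)"
      using c dom[OF t] by (simp add: charts_at_def)
    have d\<zeta>: "(\<zeta> has_vector_derivative ?v) (at t within {0..T})"
      unfolding \<zeta>_def v_def
      by (rule has_vector_derivative_within_subset[OF geodesic_has_vector_derivative[OF t1 cc] sub])
    have "(v has_vector_derivative - w) (at t within {0..1})"
      using \<gamma> t1 cc unfolding geodesic_def v_def w_def \<zeta>_def by blast
    then have dv: "(v has_vector_derivative - w) (at t within {0..T})"
      using has_vector_derivative_within_subset sub by blast
    have dv_inner: "((\<lambda>t. v t \<bullet> b) has_real_derivative - w \<bullet> b) (at t within {0..T})" for b
      unfolding has_real_derivative_iff_has_vector_derivative
      using bounded_linear.has_vector_derivative[OF bounded_linear_inner_left dv] .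
    have dlow: "((\<lambda>t. lower_index c (\<zeta> t) i) has_vector_derivative lower_index_deriv c ?z ?v i)
        (at t within {0..T})" for i
      using vector_derivative_diff_chain_within[OF d\<zeta>
          has_derivative_at_withinI[OF lower_index_has_derivative[OF c z[OF t]]]] by (simp add: o_def)
    have dprod: "((\<lambda>t. lower_index c (\<zeta> t) i \<bullet> v t) has_real_derivative
        lower_index c ?z i \<bullet> - w + lower_index_deriv c ?z ?v i \<bullet> ?v) (at t within {0..T})" for i
      unfolding has_real_derivative_iff_has_vector_derivative
      by (rule bounded_bilinear.has_vector_derivative[OF bounded_bilinear_inner dlow dv])
    have "(E has_real_derivative (\<Sum>i\<in>Basis. (- w \<bullet> i) * (lower_index c ?z i \<bullet> ?v)
        + (lower_index c ?z i \<bullet> - w + lower_index_deriv c ?z ?v i \<bullet> ?v) * (?v \<bullet> i))) (at t within {0..T})"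
      unfolding E_def by (intro DERIV_sum DERIV_mult dv_inner dprod)
    moreover have "(\<Sum>i\<in>Basis. (- w \<bullet> i) * (lower_index c ?z i \<bullet> ?v)
        + (lower_index c ?z i \<bullet> - w + lower_index_deriv c ?z ?v i \<bullet> ?v) * (?v \<bullet> i)) = 0"
    proof -
      have d: "(\<Sum>i\<in>Basis. (?v \<bullet> i) * (lower_index_deriv c ?z ?v i \<bullet> ?v)) = lower_index_deriv c ?z ?v ?v \<bullet> ?v"
        using arg_cong[OF lower_index_deriv_expansion[OF c z[OF t], of ?v ?v], of "\<lambda>x. x \<bullet> ?v"]
        by (simp add: inner_sum_left)
      have "(\<Sum>i\<in>Basis. (- w \<bullet> i) * (lower_index c ?z i \<bullet> ?v)
          + (lower_index c ?z i \<bullet> - w + lower_index_deriv c ?z ?v i \<bullet> ?v) * (?v \<bullet> i))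
        = - (\<Sum>i\<in>Basis. (w \<bullet> i) * (lower_index c ?z i \<bullet> ?v))
          - (\<Sum>i\<in>Basis. (?v \<bullet> i) * (lower_index c ?z i \<bullet> w))
          + (\<Sum>i\<in>Basis. (?v \<bullet> i) * (lower_index_deriv c ?z ?v i \<bullet> ?v))"
        by (simp add: sum.distrib sum_negf sum_subtractf algebra_simps)
      also have "\<dots> = - metric_in_chart M c ?z w ?v - metric_in_chart M c ?z ?v w
          + lower_index_deriv c ?z ?v ?v \<bullet> ?v"
        by (simp only: d expand[OF t])
      also have "\<dots> = 0"
        using koszul[OF c z[OF t], of ?v ?v ?v] metric_in_chart_sym[OF c z[OF t], of ?v w]
        by (simp add: w_def)
      finally show ?thesis .
    qed
    ultimately show ?thesis
      by simp
  qed
  then obtain C where C: "\<And>t. t \<in> {0..T} \<Longrightarrow> E t = C"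
    using has_field_derivative_zero_constant[of "{0..T}" E] by auto
  have "E t = metric_in_chart M c (coord c (\<gamma> t)) (velocity M \<gamma> t c) (velocity M \<gamma> t c)" if "t \<in> {0..T}" for t
    using expand[OF that] by (simp add: E_def v_def \<zeta>_def)
  then show ?thesis
    using C[OF t] C[of 0] t by force
qed

end

text \<open>The metric is positive and continuous on the compact set of unit vectors over \<open>K\<close>; homogeneity extends
  the bound to all vectors.\<close>

lemma metric_in_chart_lower_bound:
  assumes c: "c \<in> atlas M" and K: "compact K" "K \<subseteq> coord c ` chart_dom c"
  obtains m where "m > 0" "\<And>z a. z \<in> K \<Longrightarrow> m * (norm a)\<^sup>2 \<le> metric_in_chart M c z a a"
proof (cases "K = {}")
  case True
  then show ?thesis
    using that[of 1] by simp
next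
  case False
  let ?S = "K \<times> sphere (0::'e) 1"
  define G where "G = (\<lambda>(z, a). metric_in_chart M c z a a)"
  have Geq: "G p = (\<Sum>i\<in>Basis. (snd p \<bullet> i) * (lower_index c (fst p) i \<bullet> snd p))" if "p \<in> ?S" for p
  proof -
    have "fst p \<in> coord c ` chart_dom c"
      using that K by auto
    then show ?thesis
      using arg_cong[OF linear_euclidean_expansion[OF linear_lower_index[OF c], of "fst p" "snd p"], of "\<lambda>x. x \<bullet> snd p"]
      by (simp add: inner_sum_left lower_index_inner[OF c] G_def case_prod_beta)
  qed
  have "continuous_on (coord c ` chart_dom c) (\<lambda>z. lower_index c z i)" for i
    unfolding lower_index_def
    by (intro continuous_intros smooth_on_imp_continuous_on[OF smooth_on_metric_in_chart[OF c]])
  then have "continuous_on ?S (\<lambda>p. lower_index c (fst p) i)" for i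
    by (rule continuous_on_compose2[OF _ continuous_on_fst[OF continuous_on_id]]) (use K in auto)
  then have "continuous_on ?S (\<lambda>p. \<Sum>i\<in>Basis. (snd p \<bullet> i) * (lower_index c (fst p) i \<bullet> snd p))"
    by (intro continuous_intros)
  then have cont: "continuous_on ?S G"
    by (rule continuous_on_eq) (simp add: Geq)
  have "compact ?S" "?S \<noteq> {}"
    using K(1) False by (auto intro!: compact_Times)
  from continuous_attains_inf[OF this cont]
  obtain p where p: "p \<in> ?S" "\<And>q. q \<in> ?S \<Longrightarrow> G p \<le> G q"
    by blast
  have pos: "G p > 0"
  proof -
    have "fst p \<in> coord c ` chart_dom c" "snd p \<noteq> 0"
      using p(1) K by auto
    from metric_in_chart_pos[OF c this] show ?thesis
      by (simp add: G_def case_prod_beta)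
  qed
  have "G p * (norm a)\<^sup>2 \<le> metric_in_chart M c z a a" if z: "z \<in> K" for z a
  proof (cases "a = 0")
    case True
    then show ?thesis
      using bilinear_lzero[OF bilinear_metric_in_chart[OF c]] z K by auto
  next
    case a: False
    have zU: "z \<in> coord c ` chart_dom c"
      using z K by blast
    define b where "b = a /\<^sub>R norm a"
    have "b \<in> sphere 0 1" and ab: "a = norm a *\<^sub>R b"
      using a by (simp_all add: b_def)
    then have "G p \<le> metric_in_chart M c z b b"
      using p(2)[of "(z, b)"] z by (simp add: G_def)
    moreover have "metric_in_chart M c z a a = (norm a)\<^sup>2 * metric_in_chart M c z b b"
      by (subst (1 2) ab)
        (simp add: metric_in_chart_scaleR_left[OF c zU] metric_in_chart_scaleR_right[OF c zU] power2_eq_square)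
    ultimately show ?thesis
      by (simp add: mult.commute mult_right_mono)
  qed
  then show ?thesis
    using that pos by blast
qed

text \<open>A geodesic on \<open>[0, 1]\<close> has constant speed, so its initial speed is its length. If it ends at a
  point with coordinates \<open>w\<close> near the coordinates \<open>z\<close> of its starting point, then it travels at least
  the coordinate distance \<open>\<bar>w - z\<bar>\<close> before it leaves the coordinate ball of that radius, whatever it
  does afterwards; and inside the ball the metric is comparable to the Euclidean one.\<close>

lemma geodesic_initial_speed_ge:
  assumes c: "c \<in> charts_at M p"
  obtains m r where "m > 0" "r > 0" "ball (coord c p) r \<subseteq> coord c ` chart_dom c"
    "\<And>\<gamma> w. geodesic M \<gamma> \<Longrightarrow> \<gamma> 0 = p \<Longrightarrow> \<gamma> 1 = chart_inv c w \<Longrightarrow> w \<in> ball (coord c p) r \<Longrightarrow>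
      m * (norm (w - coord c p))\<^sup>2 \<le> rmetric M p (velocity M \<gamma> 0) (velocity M \<gamma> 0)"
proof -
  let ?z = "coord c p" and ?U = "coord c ` chart_dom c"
  note c' = charts_atD(1)[OF c]
  obtain r where r: "r > 0" "cball ?z r \<subseteq> ?U"
    using open_chart_image[OF c'] coord_in_image[OF c] open_contains_cball by blast
  obtain m where m: "m > 0" "\<And>y a. y \<in> cball ?z r \<Longrightarrow> m * (norm a)\<^sup>2 \<le> metric_in_chart M c y a a"
    using metric_in_chart_lower_bound[OF c' compact_cball r(2)] by blast
  have "m * (norm (w - ?z))\<^sup>2 \<le> rmetric M p (velocity M \<gamma> 0) (velocity M \<gamma> 0)"
    if \<gamma>: "geodesic M \<gamma>" and \<gamma>0: "\<gamma> 0 = p" and \<gamma>1: "\<gamma> 1 = chart_inv c w" and w: "w \<in> ball ?z r" for \<gamma> w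
  proof -
    define v where "v = (\<lambda>t. velocity M \<gamma> t c)"
    define s where "s = norm (w - ?z)"
    have s: "s < r"
      using w by (simp add: s_def dist_norm norm_minus_commute)
    have wU: "w \<in> ?U"
      using w r by auto
    have v0: "velocity M \<gamma> 0 \<in> tangent_space M p"
      using velocity_in_tangent_space[OF \<gamma>, of 0] \<gamma>0 by simp
    have E0: "rmetric M p (velocity M \<gamma> 0) (velocity M \<gamma> 0) = metric_in_chart M c ?z (v 0) (v 0)"
      unfolding v_def by (rule metric_in_chart_coord[OF c v0 v0, symmetric])
    show ?thesis
    proof (cases "s = 0")
      case True
      have "0 \<le> m * (norm (v 0))\<^sup>2"
        using m(1) by simp
      then have "0 \<le> rmetric M p (velocity M \<gamma> 0) (velocity M \<gamma> 0)"
        unfolding E0 by (rule order_trans[OF _ m(2)]) (use r in simp)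
      then show ?thesis
        using True by (simp add: s_def)
    next
      case False
      then have spos: "s > 0"
        by (simp add: s_def)
      let ?O = "chart_dom c \<inter> coord c -` ball ?z s" and ?K = "chart_inv c ` cball ?z s"
      have sr: "cball ?z s \<subseteq> ?U"
        using s r by (auto intro: order_trans)
      have openO: "open ?O"
        by (rule continuous_open_preimage[OF continuous_on_coord[OF c'] open_chart_dom[OF c'] open_ball])
      have "compact ?K"
        by (rule compact_continuous_image[OF continuous_on_subset[OF continuous_on_chart_inv[OF c'] sr] compact_cball])
      then have closedK: "closed ?K"
        by (rule compact_imp_closed)
      have inK: "q \<in> chart_dom c" "coord c q \<in> cball ?z s" if "q \<in> ?K" for q
        using that sr chart_inv_in_dom[OF c'] coord_chart_inv[OF c'] by (auto simp: subset_iff)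
      have OK: "?O \<subseteq> ?K"
      proof
        fix q
        assume "q \<in> ?O"
        then show "q \<in> ?K"
          using chart_inv_coord[OF c', of q] by (intro image_eqI[of _ _ "coord c q"]) auto
      qed
      have cont: "continuous_on {0..1} \<gamma>"
        using \<gamma> by (simp add: geodesic_def)
      define Z where "Z = {0..1} \<inter> \<gamma> -` (- ?O)"
      have Z: "closed Z"
        unfolding Z_def by (rule continuous_closed_preimage[OF cont closed_atLeastAtMost closed_Compl[OF openO]])
      have Z1: "1 \<in> Z"
        using \<gamma>1 coord_chart_inv[OF c' wU] by (simp add: Z_def s_def dist_norm norm_minus_commute)
      have bdd: "bdd_below Z"
        by (rule bdd_belowI[of _ 0]) (simp add: Z_def)
      \<comment> \<open>The time of first exit from the coordinate ball of radius \<open>s\<close>.\<close>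
      define T where "T = Inf Z"
      have TZ: "T \<in> Z"
        unfolding T_def by (rule closed_contains_Inf[OF _ bdd Z]) (use Z1 in blast)
      have Tle: "T \<le> t" if "t \<in> Z" for t
        unfolding T_def by (rule cInf_lower[OF that bdd])
      have "0 \<notin> Z"
        using \<gamma>0 charts_atD(2)[OF c] spos by (simp add: Z_def)
      then have T: "0 < T" "T \<le> 1"
        using TZ by (auto simp: Z_def less_le)
      have before: "\<gamma> t \<in> ?K" if "t \<in> {0..<T}" for t
        using Tle[of t] that T OK by (force simp: Z_def)
      have "closed ({0..1} \<inter> \<gamma> -` ?K)"
        by (rule continuous_closed_preimage[OF cont _ closedK]) simp
      then have "closure {0..<T} \<subseteq> {0..1} \<inter> \<gamma> -` ?K"
        using before T by (intro closure_minimal) auto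
      then have upto: "\<gamma> t \<in> ?K" if "t \<in> {0..T}" for t
        using that T by auto
      have dom: "\<gamma> t \<in> chart_dom c" and in_ball: "coord c (\<gamma> t) \<in> cball ?z r" if "t \<in> {0..T}" for t
        using inK[OF upto[OF that]] s by auto
      have far: "s \<le> norm (coord c (\<gamma> T) - ?z)"
        using TZ dom[of T] T by (auto simp: Z_def dist_norm norm_minus_commute)
      define E where "E = metric_in_chart M c ?z (v 0) (v 0)"
      have speed: "m * (norm (v t))\<^sup>2 \<le> E" if "t \<in> {0..T}" for t
        using m(2)[OF in_ball[OF that], of "v t"] geodesic_speed_constant[OF \<gamma> c' T(2) dom that] \<gamma>0
        by (simp add: E_def v_def)
      have bound: "norm (v t) \<le> sqrt (E / m)" if "t \<in> {0..T}" for t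
        using speed[OF that] m(1) by (intro real_le_rsqrt) (simp add: pos_le_divide_eq mult.commute)
      have der: "((\<lambda>t. coord c (\<gamma> t)) has_vector_derivative v t) (at t within {0..1})" if "t \<in> {0..T}" for t
        unfolding v_def using that T c' dom[OF that]
        by (intro geodesic_has_vector_derivative[OF \<gamma>]) (auto simp: charts_at_def)
      have "norm (coord c (\<gamma> T) - coord c (\<gamma> 0)) \<le> sqrt (E / m) * T - sqrt (E / m) * 0"
      proof (rule differentiable_bound_general[OF T(1), where f' = v and \<phi>' = "\<lambda>_. sqrt (E / m)"])
        show "continuous_on {0..T} (\<lambda>t. coord c (\<gamma> t))"
          by (rule continuous_on_vector_derivative,
              rule has_vector_derivative_within_subset[OF der]) (use T in auto)
        show "((\<lambda>t. coord c (\<gamma> t)) has_vector_derivative v t) (at t)" if "0 < t" "t < T" for t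
          using der[of t] that T by (simp add: at_within_Icc_at)
        show "((*) (sqrt (E / m)) has_vector_derivative sqrt (E / m)) (at t)" for t
          unfolding has_real_derivative_iff_has_vector_derivative[symmetric]
          by (auto intro!: derivative_eq_intros)
      qed (use bound in \<open>auto intro!: continuous_intros\<close>)
      moreover have E_nonneg: "0 \<le> E"
        by (rule order_trans[OF _ speed[of 0]]) (use m(1) T in auto)
      moreover from this have "sqrt (E / m) * T \<le> sqrt (E / m)"
        using T m(1) by (intro mult_left_le) auto
      ultimately have "s \<le> sqrt (E / m)"
        using far \<gamma>0 by simp
      then have "s\<^sup>2 \<le> E / m"
        using power_mono[of s "sqrt (E / m)" 2] spos E_nonneg m(1) by simp
      then show ?thesis
        using m(1) by (simp add: s_def[symmetric] E0 E_def[symmetric] pos_le_divide_eq mult.commute)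
    qed
  qed
  then show ?thesis
    using that[OF m(1) r(1)] r(2) ball_subset_cball by (meson order_trans)
qed


subsection \<open>Critical points of strongly convex functions\<close>

lemma strongly_convex_geodesic_ge:
  assumes "geodesic_strongly_convex M \<mu> h" and \<gamma>: "geodesic M \<gamma>" and crit: "gradient M h (\<gamma> 0) = 0"
  shows "h (\<gamma> 0) + \<mu> / 2 * rmetric M (\<gamma> 0) (velocity M \<gamma> 0) (velocity M \<gamma> 0) \<le> h (\<gamma> 1)"
proof -
  have "rmetric M (\<gamma> 0) 0 (velocity M \<gamma> 0) = 0"
    by (rule rmetric_zero_left[OF velocity_in_tangent_space[OF \<gamma>]]) simp
  then show ?thesis
    using assms(1)[unfolded geodesic_strongly_convex_def, THEN conjunct2, rule_format, OF \<gamma>, of 1] crit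
    by (simp add: Let_def)
qed

text \<open>Strong convexity along a geodesic that starts at a critical point has no first-order term.\<close>

lemma critical_point_minimizes:
  assumes conv: "geodesically_convex M" and sc: "geodesic_strongly_convex M \<mu> h"
    and crit: "gradient M h p = 0"
  shows "h p \<le> h q"
proof -
  obtain \<gamma> where \<gamma>: "geodesic M \<gamma>" "\<gamma> 0 = p" "\<gamma> 1 = q"
    using conv unfolding geodesically_convex_def by blast
  have vT: "velocity M \<gamma> 0 \<in> tangent_space M (\<gamma> 0)"
    by (rule velocity_in_tangent_space[OF \<gamma>(1)]) simp
  have "0 \<le> rmetric M (\<gamma> 0) (velocity M \<gamma> 0) (velocity M \<gamma> 0)"
    using rmetric_pos[OF vT vT] rmetric_zero_left[OF vT] by (cases "velocity M \<gamma> 0 = 0") auto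
  moreover have "\<mu> > 0"
    using sc by (simp add: geodesic_strongly_convex_def)
  ultimately have "0 \<le> \<mu> / 2 * rmetric M (\<gamma> 0) (velocity M \<gamma> 0) (velocity M \<gamma> 0)"
    by simp
  then show ?thesis
    using strongly_convex_geodesic_ge[OF sc \<gamma>(1)] crit \<gamma>(2,3) by simp
qed

text \<open>Every point near \<open>p\<close> is joined to \<open>p\<close> by a geodesic, whose initial speed is at least
  proportional to the coordinate distance. So strong convexity gives quadratic growth in
  coordinates, which bounds the second derivative from below.\<close>

lemma second_derivative_pos_at_critical_point:
  assumes conv: "geodesically_convex M" and sc: "geodesic_strongly_convex M \<mu> h"
    and h: "smooth_fun (atlas M) h" and crit: "gradient M h p = 0"
    and c: "c \<in> charts_at M p" and a: "a \<noteq> 0"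
  shows "second_derivative (h \<circ> chart_inv c) (coord c p) a a > 0"
proof -
  let ?z = "coord c p" and ?h = "h \<circ> chart_inv c"
  note c' = charts_atD(1)[OF c]
  obtain m r where m: "m > 0" and r: "r > 0" "ball ?z r \<subseteq> coord c ` chart_dom c"
    and speed: "\<And>\<gamma> w. geodesic M \<gamma> \<Longrightarrow> \<gamma> 0 = p \<Longrightarrow> \<gamma> 1 = chart_inv c w \<Longrightarrow> w \<in> ball ?z r \<Longrightarrow>
      m * (norm (w - ?z))\<^sup>2 \<le> rmetric M p (velocity M \<gamma> 0) (velocity M \<gamma> 0)"
    using geodesic_initial_speed_ge[OF c] by metis
  have \<mu>: "\<mu> > 0"
    using sc by (simp add: geodesic_strongly_convex_def)
  have hs: "smooth_on (coord c ` chart_dom c) ?h"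
    using h c' unfolding smooth_fun_def by blast
  have growth: "?h ?z + \<mu> / 2 * m * (norm (w - ?z))\<^sup>2 \<le> ?h w" if w: "w \<in> ball ?z r" for w
  proof -
    obtain \<gamma> where \<gamma>: "geodesic M \<gamma>" "\<gamma> 0 = p" "\<gamma> 1 = chart_inv c w"
      using conv unfolding geodesically_convex_def by blast
    have "\<mu> / 2 * (m * (norm (w - ?z))\<^sup>2) \<le> \<mu> / 2 * rmetric M p (velocity M \<gamma> 0) (velocity M \<gamma> 0)"
      using speed[OF \<gamma> w] \<mu> by (intro mult_left_mono) auto
    then show ?thesis
      using strongly_convex_geodesic_ge[OF sc \<gamma>(1)] crit \<gamma>(2,3)
      by (simp add: chart_inv_coord_at[OF c] mult.assoc)
  qed
  have dh: "(?h has_derivative frechet_derivative ?h (at ?z)) (at ?z)"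
    by (rule smooth_on_imp_has_derivative[OF hs coord_in_image[OF c]])
  have zero: "frechet_derivative ?h (at ?z) a = 0"
    using metric_in_chart_gradient[OF c dh, of a] crit
      bilinear_lzero[OF bilinear_metric_in_chart[OF c' coord_in_image[OF c]]] by simp
  have "2 * (\<mu> / 2 * m) * (norm a)\<^sup>2 \<le> second_derivative ?h ?z a a"
  proof (rule second_derivative_ge_quadratic_growth[OF open_ball _ _ _ zero growth])
    show "?z \<in> ball ?z r"
      using r by simp
    show "?h differentiable (at y)" if "y \<in> ball ?z r" for y
      using smooth_on_imp_differentiable[OF hs] that r by blast
    show "(\<lambda>y. frechet_derivative ?h (at y) a) differentiable (at ?z)"
      by (rule smooth_on_imp_differentiable[OF smooth_on_frechet_derivative[OF hs] coord_in_image[OF c]])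
  qed
  moreover have "2 * (\<mu> / 2 * m) * (norm a)\<^sup>2 > 0"
    using \<mu> m a by simp
  ultimately show ?thesis
    by linarith
qed

end


section \<open>Functions on a product of manifolds\<close>

lemma (in riemannian) gradient_eq_zeroI:
  assumes c: "c \<in> charts_at M p" and h: "((h \<circ> chart_inv c) has_derivative (\<lambda>_. 0)) (at (coord c p))"
  shows "gradient M h p = 0"
proof (rule gradient_eqI[OF tangent_space_zero])
  fix v
  assume v: "v \<in> tangent_space M p"
  show "rmetric M p 0 v = fun_diff M h p v"
    by (simp only: rmetric_zero_left[OF v] fun_diff_in_chart[OF c v h])
qed

lemma (in riemannian) gradient_zero_at_minimizer:
  assumes h: "smooth_fun (atlas M) h" and min: "\<And>q. h p \<le> h q"
  shows "gradient M h p = 0"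
proof (rule gradient_eq_zeroI[OF some_chart_in])
  let ?c = "some_chart M p" and ?h = "h \<circ> chart_inv (some_chart M p)"
  note c = some_chart_in[of p]
  have "smooth_on (coord ?c ` chart_dom ?c) ?h"
    using h charts_atD(1)[OF c] unfolding smooth_fun_def by blast
  from smooth_on_imp_has_derivative[OF this coord_in_image[OF c]]
  have d: "(?h has_derivative frechet_derivative ?h (at (coord ?c p))) (at (coord ?c p))" .
  have "frechet_derivative ?h (at (coord ?c p)) = (\<lambda>_. 0)"
    by (rule has_derivative_local_min[OF d]) (simp add: chart_inv_coord_at[OF c] min)
  with d show "(?h has_derivative (\<lambda>_. 0)) (at (coord ?c p))"
    by simp
qed

definition in_charts ::
  "('a \<times> 'b \<Rightarrow> 'v) \<Rightarrow> ('a, 'e) chart \<Rightarrow> ('b, 'f) chart \<Rightarrow> 'e \<times> 'f \<Rightarrow> 'v" where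
  "in_charts \<phi> c d p = \<phi> (chart_inv c (fst p), chart_inv d (snd p))"

locale riemannian_pair = X: riemannian Mx + Y: riemannian My
  for Mx :: "('a::{t2_space, second_countable_topology}, 'e::euclidean_space) rmanifold"
    and My :: "('b::{t2_space, second_countable_topology}, 'f::euclidean_space) rmanifold"
begin

lemma open_chart_image_Times:
  "c \<in> atlas Mx \<Longrightarrow> d \<in> atlas My \<Longrightarrow> open (coord c ` chart_dom c \<times> coord d ` chart_dom d)"
  by (intro open_Times X.open_chart_image Y.open_chart_image)

lemma smooth_on_in_charts:
  assumes \<phi>: "smooth_fun (prod_atlas (atlas Mx) (atlas My)) \<phi>"
    and c: "c \<in> atlas Mx" and d: "d \<in> atlas My"
  shows "smooth_on (coord c ` chart_dom c \<times> coord d ` chart_dom d) (in_charts \<phi> c d)"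
proof -
  define k where "k = (chart_dom c \<times> chart_dom d, map_prod (coord c) (coord d))"
  have "k \<in> prod_atlas (atlas Mx) (atlas My)"
    unfolding k_def prod_atlas_def using c d by blast
  then have smooth: "smooth_on (coord k ` chart_dom k) (\<phi> \<circ> chart_inv k)"
    using \<phi> unfolding smooth_fun_def by blast
  have img: "coord k ` chart_dom k = coord c ` chart_dom c \<times> coord d ` chart_dom d"
    by (auto simp: k_def intro!: rev_image_eqI)
  have eq: "(\<phi> \<circ> chart_inv k) p = in_charts \<phi> c d p"
    if p: "p \<in> coord c ` chart_dom c \<times> coord d ` chart_dom d" for p
  proof -
    have inj: "inj_on (coord k) (chart_dom k)"
    proof (rule inj_onI)
      fix p q
      assume "p \<in> chart_dom k" "q \<in> chart_dom k" "coord k p = coord k q"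
      then show "p = q"
        using X.chart_inv_coord[OF c] Y.chart_inv_coord[OF d] by (cases p; cases q) (auto simp: k_def, metis+)
    qed
    have "chart_inv k p = (chart_inv c (fst p), chart_inv d (snd p))"
      unfolding chart_inv_def[of k]
    proof (rule inv_into_f_eq[OF inj])
      show "(chart_inv c (fst p), chart_inv d (snd p)) \<in> chart_dom k"
        using p X.chart_inv_in_dom[OF c, of "fst p"] Y.chart_inv_in_dom[OF d, of "snd p"] by (auto simp: k_def)
      show "coord k (chart_inv c (fst p), chart_inv d (snd p)) = p"
        using p X.coord_chart_inv[OF c, of "fst p"] Y.coord_chart_inv[OF d, of "snd p"] by (auto simp: k_def)
    qed
    then show ?thesis
      by (simp add: in_charts_def)
  qed
  show ?thesis
    by (rule smooth_on_cong[OF open_chart_image_Times[OF c d] eq smooth[unfolded img]])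
qed

lemma smooth_fun_section:
  assumes \<phi>: "smooth_fun (prod_atlas (atlas Mx) (atlas My)) \<phi>"
  shows "smooth_fun (atlas My) (\<lambda>y. \<phi> (x, y))"
  unfolding smooth_fun_def
proof
  fix d
  assume d: "d \<in> atlas My"
  note c = X.some_chart_in[of x]
  from smooth_on_slice[OF X.coord_in_image[OF c] Y.open_chart_image[OF d]
      smooth_on_in_charts[OF \<phi> X.charts_atD(1)[OF c] d]]
  show "smooth_on (coord d ` chart_dom d) ((\<lambda>y. \<phi> (x, y)) \<circ> chart_inv d)"
    by (simp add: in_charts_def o_def X.chart_inv_coord_at[OF c])
qed

context
  fixes \<phi> :: "'a \<times> 'b \<Rightarrow> real" and x :: 'a and y :: 'b and c :: "('a, 'e) chart" and d :: "('b, 'f) chart"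
  assumes \<phi>: "smooth_fun (prod_atlas (atlas Mx) (atlas My)) \<phi>"
    and c: "c \<in> charts_at Mx x" and d: "d \<in> charts_at My y"
begin

lemmas smooth_\<phi> = smooth_on_in_charts[OF \<phi> X.charts_atD(1)[OF c] Y.charts_atD(1)[OF d]]

lemma in_charts_base: "(coord c x, coord d y) \<in> coord c ` chart_dom c \<times> coord d ` chart_dom d"
  using X.coord_in_image[OF c] Y.coord_in_image[OF d] by simp

lemma section_y_has_derivative:
  assumes "z \<in> coord c ` chart_dom c" "w \<in> coord d ` chart_dom d"
  shows "((\<lambda>y. \<phi> (chart_inv c z, y)) \<circ> chart_inv d has_derivative
      (\<lambda>b. frechet_derivative (in_charts \<phi> c d) (at (z, w)) (0, b))) (at w)"
  using has_derivative_slice_snd[OF smooth_on_imp_has_derivative[OF smooth_\<phi>]] assms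
  by (simp add: in_charts_def o_def)

lemma section_x_has_derivative:
  assumes "z \<in> coord c ` chart_dom c" "w \<in> coord d ` chart_dom d"
  shows "((\<lambda>x. \<phi> (x, chart_inv d w)) \<circ> chart_inv c has_derivative
      (\<lambda>a. frechet_derivative (in_charts \<phi> c d) (at (z, w)) (a, 0))) (at z)"
  using has_derivative_slice_fst[OF smooth_on_imp_has_derivative[OF smooth_\<phi>]] assms
  by (simp add: in_charts_def o_def)

lemma
  shows grad_y_in_tangent_space: "grad_y My \<phi> x y \<in> tangent_space My y"
    and rmetric_grad_y: "w \<in> tangent_space My y \<Longrightarrow> rmetric My y (grad_y My \<phi> x y) w =
      frechet_derivative (in_charts \<phi> c d) (at (coord c x, coord d y)) (0, w d)"
  using Y.gradient_in_tangent_space[OF d] Y.rmetric_gradient[OF d]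
    section_y_has_derivative[OF X.coord_in_image[OF c] Y.coord_in_image[OF d]]
  by (simp_all add: grad_y_def X.chart_inv_coord_at[OF c])

lemma
  shows grad_x_in_tangent_space: "grad_x Mx \<phi> x y \<in> tangent_space Mx x"
    and rmetric_grad_x: "u \<in> tangent_space Mx x \<Longrightarrow> rmetric Mx x (grad_x Mx \<phi> x y) u =
      frechet_derivative (in_charts \<phi> c d) (at (coord c x, coord d y)) (u c, 0)"
  using X.gradient_in_tangent_space[OF c] X.rmetric_gradient[OF c]
    section_x_has_derivative[OF X.coord_in_image[OF c] Y.coord_in_image[OF d]]
  by (simp_all add: grad_x_def Y.chart_inv_coord_at[OF d])

lemma
  assumes u: "u \<in> tangent_space Mx x"
  shows cross_yx_in_tangent_space: "cross_yx Mx My \<phi> x y u \<in> tangent_space My y"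
    and rmetric_cross_yx: "w \<in> tangent_space My y \<Longrightarrow> rmetric My y (cross_yx Mx My \<phi> x y u) w =
      second_derivative (in_charts \<phi> c d) (coord c x, coord d y) (u c, 0) (0, w d)"
proof -
  have K: "((\<lambda>z. frechet_derivative (in_charts \<phi> c d) (at (z, coord d y)) (0, b)) has_derivative
      (\<lambda>a. second_derivative (in_charts \<phi> c d) (coord c x, coord d y) (a, 0) (0, b))) (at (coord c x))" for b
    by (rule has_derivative_slice_fst[OF second_derivative_has_derivative[OF smooth_\<phi> in_charts_base]])
  note cd = Y.cross_derivative[OF X.riemannian_axioms c d
      section_y_has_derivative[OF _ Y.coord_in_image[OF d]] K u]
  show "cross_yx Mx My \<phi> x y u \<in> tangent_space My y"
    unfolding cross_yx_def grad_y_def by (rule cd(1))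
  show "w \<in> tangent_space My y \<Longrightarrow> rmetric My y (cross_yx Mx My \<phi> x y u) w =
      second_derivative (in_charts \<phi> c d) (coord c x, coord d y) (u c, 0) (0, w d)"
    unfolding cross_yx_def grad_y_def by (rule cd(2))
qed

lemma
  assumes v: "v \<in> tangent_space My y"
  shows cross_xy_in_tangent_space: "cross_xy Mx My \<phi> x y v \<in> tangent_space Mx x"
    and rmetric_cross_xy: "u \<in> tangent_space Mx x \<Longrightarrow> rmetric Mx x (cross_xy Mx My \<phi> x y v) u =
      second_derivative (in_charts \<phi> c d) (coord c x, coord d y) (0, v d) (u c, 0)"
proof -
  have K: "((\<lambda>w. frechet_derivative (in_charts \<phi> c d) (at (coord c x, w)) (a, 0)) has_derivative
      (\<lambda>b. second_derivative (in_charts \<phi> c d) (coord c x, coord d y) (0, b) (a, 0))) (at (coord d y))" for a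
    by (rule has_derivative_slice_snd[OF second_derivative_has_derivative[OF smooth_\<phi> in_charts_base]])
  note cd = X.cross_derivative[OF Y.riemannian_axioms d c
      section_x_has_derivative[OF X.coord_in_image[OF c]] K v]
  show "cross_xy Mx My \<phi> x y v \<in> tangent_space Mx x"
    unfolding cross_xy_def grad_x_def by (rule cd(1))
  show "u \<in> tangent_space Mx x \<Longrightarrow> rmetric Mx x (cross_xy Mx My \<phi> x y v) u =
      second_derivative (in_charts \<phi> c d) (coord c x, coord d y) (0, v d) (u c, 0)"
    unfolding cross_xy_def grad_x_def by (rule cd(2))
qed

lemma second_derivative_section_y:
  "second_derivative ((\<lambda>y. \<phi> (x, y)) \<circ> chart_inv d) (coord d y) a b =
    second_derivative (in_charts \<phi> c d) (coord c x, coord d y) (0, a) (0, b)"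
  using second_derivative_slice[OF Y.open_chart_image[OF Y.charts_atD(1)[OF d]]
      X.coord_in_image[OF c] Y.coord_in_image[OF d] smooth_\<phi>, of a b]
  by (simp add: in_charts_def o_def X.chart_inv_coord_at[OF c])

lemma second_derivative_in_charts_symmetric:
  "second_derivative (in_charts \<phi> c d) (coord c x, coord d y) p q =
    second_derivative (in_charts \<phi> c d) (coord c x, coord d y) q p"
  by (rule second_derivative_symmetric[OF
        open_chart_image_Times[OF X.charts_atD(1)[OF c] Y.charts_atD(1)[OF d]] in_charts_base])
    (rule smooth_on_imp_differentiable[OF smooth_\<phi>]
       smooth_on_imp_differentiable[OF smooth_on_frechet_derivative[OF smooth_\<phi>] in_charts_base], assumption?)+

lemma bilinear_second_derivative_in_charts:
  "bilinear (second_derivative (in_charts \<phi> c d) (coord c x, coord d y))"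
  by (rule bilinear_second_derivative[OF
        open_chart_image_Times[OF X.charts_atD(1)[OF c] Y.charts_atD(1)[OF d]] in_charts_base smooth_\<phi>])

end

end


section \<open>The hypergradient\<close>

locale strongly_convex_lower_level = riemannian_pair Mx My
  for Mx :: "('a::{t2_space, second_countable_topology}, 'e::euclidean_space) rmanifold"
    and My :: "('b::{t2_space, second_countable_topology}, 'f::euclidean_space) rmanifold" +
  fixes g :: "'a \<times> 'b \<Rightarrow> real" and ystar :: "'a \<Rightarrow> 'b"
  assumes conv: "geodesically_convex My"
    and g: "smooth_fun (prod_atlas (atlas Mx) (atlas My)) g"
    and sc: "\<And>x. \<exists>\<mu>. geodesic_strongly_convex My \<mu> (\<lambda>y. g (x, y))"
    and ystar: "\<And>x y. is_arg_min (\<lambda>y. g (x, y)) (\<lambda>_. True) y \<longleftrightarrow> y = ystar x"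
begin

text \<open>For a strongly convex function every critical point is a global minimizer, so the critical points of
  \<open>g (x, \<cdot>)\<close> are exactly described by the argmin hypothesis.\<close>

lemma gradient_zero_iff: "gradient My (\<lambda>y. g (x, y)) y = 0 \<longleftrightarrow> y = ystar x"
proof
  assume crit: "gradient My (\<lambda>y. g (x, y)) y = 0"
  obtain \<mu> where "geodesic_strongly_convex My \<mu> (\<lambda>y. g (x, y))"
    using sc by blast
  then have "g (x, y) \<le> g (x, q)" for q
    using Y.critical_point_minimizes[OF conv _ crit] by blast
  then have "is_arg_min (\<lambda>y. g (x, y)) (\<lambda>_. True) y"
    by (simp add: is_arg_min_linorder)
  then show "y = ystar x"
    using ystar by blast
next
  assume "y = ystar x"
  then have "is_arg_min (\<lambda>y. g (x, y)) (\<lambda>_. True) y"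
    using ystar by blast
  then have "g (x, y) \<le> g (x, q)" for q
    by (simp add: is_arg_min_linorder)
  then show "gradient My (\<lambda>y. g (x, y)) y = 0"
    by (rule Y.gradient_zero_at_minimizer[OF smooth_fun_section[OF g]])
qed

context
  fixes x :: 'a and c :: "('a, 'e) chart" and d :: "('b, 'f) chart"
  assumes c: "c \<in> charts_at Mx x" and d: "d \<in> charts_at My (ystar x)"
begin

abbreviation (input) "G \<equiv> in_charts g c d"
abbreviation (input) "B \<equiv> second_derivative (in_charts g c d) (coord c x, coord d (ystar x))"

lemma second_derivative_y_pos:
  assumes "b \<noteq> 0"
  shows "B (0, b) (0, b) > 0"
proof -
  obtain \<mu> where "geodesic_strongly_convex My \<mu> (\<lambda>y. g (x, y))"
    using sc by blast
  then have "second_derivative ((\<lambda>y. g (x, y)) \<circ> chart_inv d) (coord d (ystar x)) b b > 0"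
    using gradient_zero_iff assms
    by (intro Y.second_derivative_pos_at_critical_point[OF conv _ smooth_fun_section[OF g] _ d]) auto
  then show ?thesis
    by (simp add: second_derivative_section_y[OF g c d])
qed

text \<open>The implicit function theorem solves \<open>\<partial>\<^sub>y g (x, y) = 0\<close> near \<open>(x, ystar x)\<close>. Each solution is a
  critical point, hence the minimizer, so the local branch is \<open>ystar\<close> itself, which is
  therefore continuous and differentiable at \<open>x\<close>.\<close>

lemma ystar_in_charts:
  shows "isCont ystar x"
    and "\<exists>\<eta>'. ((\<lambda>z. coord d (ystar (chart_inv c z))) has_derivative \<eta>') (at (coord c x)) \<and>
      (\<forall>a b. B (a, \<eta>' a) (0, b) = 0)"
proof -
  let ?U = "coord c ` chart_dom c" and ?V = "coord d ` chart_dom d"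
  let ?p0 = "(coord c x, coord d (ystar x))"
  note c' = X.charts_atD(1)[OF c] and d' = Y.charts_atD(1)[OF d]
  note G = smooth_on_in_charts[OF g c' d']
  have S: "open (?U \<times> ?V)" "?p0 \<in> ?U \<times> ?V"
    using open_chart_image_Times[OF c' d'] X.coord_in_image[OF c] Y.coord_in_image[OF d] by auto
  define Q where "Q = (\<lambda>p. Y.riesz (\<lambda>b. frechet_derivative G (at p) (0, b)))"
  have lin: "linear (\<lambda>b. frechet_derivative G (at p) (0, b))" if "p \<in> ?U \<times> ?V" for p
    using has_derivative_linear[OF has_derivative_slice_snd[OF smooth_on_imp_has_derivative[OF G], of "fst p" "snd p"]]
      that by simp
  have Q0_iff: "Q p = 0 \<longleftrightarrow> (\<forall>b. frechet_derivative G (at p) (0, b) = 0)" if "p \<in> ?U \<times> ?V" for p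
  proof
    assume "Q p = 0"
    then show "\<forall>b. frechet_derivative G (at p) (0, b) = 0"
      using Y.riesz_inner[OF lin[OF that]] by (simp add: Q_def)
  qed (simp add: Q_def Y.riesz_def)
  have crit_iff: "Q (z, w) = 0 \<longleftrightarrow> ystar (chart_inv c z) = chart_inv d w" if zw: "(z, w) \<in> ?U \<times> ?V" for z w
  proof -
    have z: "z \<in> ?U" and w: "w \<in> ?V"
      using zw by auto
    note dw = Y.charts_at_chart_inv[OF d' w]
    note der = section_y_has_derivative[OF g c dw z w]
    have der': "((\<lambda>y. g (chart_inv c z, y)) \<circ> chart_inv d has_derivative
        (\<lambda>b. frechet_derivative G (at (z, w)) (0, b))) (at (coord d (chart_inv d w)))"
      using der by (simp add: Y.coord_chart_inv[OF d' w])
    have "Q (z, w) = 0 \<longleftrightarrow> gradient My (\<lambda>y. g (chart_inv c z, y)) (chart_inv d w) = 0"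
    proof
      assume "Q (z, w) = 0"
      then have "(\<lambda>b. frechet_derivative G (at (z, w)) (0, b)) = (\<lambda>_. 0)"
        using Q0_iff[OF zw] by auto
      then show "gradient My (\<lambda>y. g (chart_inv c z, y)) (chart_inv d w) = 0"
        using der' by (intro Y.gradient_eq_zeroI[OF dw]) simp
    next
      assume "gradient My (\<lambda>y. g (chart_inv c z, y)) (chart_inv d w) = 0"
      then have "frechet_derivative G (at (z, w)) (0, b) = 0" for b
        using Y.metric_in_chart_gradient[OF dw der', of b]
          bilinear_lzero[OF Y.bilinear_metric_in_chart[OF d' w]]
        by (simp add: Y.coord_chart_inv[OF d' w])
      then show "Q (z, w) = 0"
        using Q0_iff[OF zw] by blast
    qed
    also have "\<dots> \<longleftrightarrow> ystar (chart_inv c z) = chart_inv d w"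
      unfolding gradient_zero_iff by (rule eq_commute)
    finally show ?thesis .
  qed
  have dQ: "(Q has_derivative (\<lambda>v. Y.riesz (\<lambda>b. second_derivative G p v (0, b)))) (at p)"
    if "p \<in> ?U \<times> ?V" for p
    unfolding Q_def Y.riesz_def
    by (intro has_derivative_sum has_derivative_scaleR_left second_derivative_has_derivative[OF G that])
  have DQ: "frechet_derivative Q (at p) v = Y.riesz (\<lambda>b. second_derivative G p v (0, b))"
    if "p \<in> ?U \<times> ?V" for p v
    by (rule fun_cong[OF frechet_derivative_at[OF dQ[OF that]], symmetric])
  have lin2: "linear (\<lambda>b. B v (0, b))" for v
    using bilinear_radd[OF bilinear_second_derivative_in_charts[OF g c d], of v "(0, _)" "(0, _)"]
      bilinear_rmul[OF bilinear_second_derivative_in_charts[OF g c d], of v _ "(0, _)"]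
    by (intro linearI) simp_all
  have B0: "B v (0, b) = 0" if "frechet_derivative Q (at ?p0) v = 0" for v b
    using Y.riesz_inner[OF lin2, of v b] that DQ[OF S(2)] by simp
  have diff: "Q differentiable (at p)" if "p \<in> ?U \<times> ?V" for p
    using dQ[OF that] differentiableI by blast
  have cont: "continuous_on (?U \<times> ?V) (\<lambda>p. frechet_derivative Q (at p) v)" for v
  proof (rule continuous_on_eq)
    show "continuous_on (?U \<times> ?V) (\<lambda>p. Y.riesz (\<lambda>b. second_derivative G p v (0, b)))"
      unfolding Y.riesz_def second_derivative_def
      by (intro continuous_intros
          smooth_on_imp_continuous_on[OF smooth_on_frechet_derivative[OF smooth_on_frechet_derivative[OF G]]])
  qed (simp add: DQ)
  have zero: "Q ?p0 = 0"
    using crit_iff[OF S(2)] by (simp add: X.chart_inv_coord_at[OF c] Y.chart_inv_coord_at[OF d])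
  have nondeg: "b = 0" if "frechet_derivative Q (at ?p0) (0, b) = 0" for b
    using B0[OF that, of b] second_derivative_y_pos[of b] by fastforce
  obtain \<eta> \<eta>' where \<eta>0: "\<eta> (coord c x) = coord d (ystar x)"
    and \<eta>': "(\<eta> has_derivative \<eta>') (at (coord c x))"
    and ev: "\<forall>\<^sub>F z in nhds (coord c x). (z, \<eta> z) \<in> ?U \<times> ?V \<and> Q (z, \<eta> z) = 0"
    and tangent: "\<And>a. frechet_derivative Q (at ?p0) (a, \<eta>' a) = 0"
    by (rule implicit_function[OF S diff cont zero nondeg]) blast+
  obtain N where N: "open N" "coord c x \<in> N"
    and on_N: "\<And>z. z \<in> N \<Longrightarrow> (z, \<eta> z) \<in> ?U \<times> ?V \<and> Q (z, \<eta> z) = 0"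
    using ev unfolding eventually_nhds by blast
  have branch: "ystar (chart_inv c z) = chart_inv d (\<eta> z)" if "z \<in> N" for z
    using on_N[OF that] crit_iff by blast
  have "((\<lambda>z. coord d (ystar (chart_inv c z))) has_derivative \<eta>') (at (coord c x))"
    by (rule has_derivative_transform_within_open[OF \<eta>' N])
      (use on_N in \<open>auto simp: branch Y.coord_chart_inv[OF d']\<close>)
  then show "\<exists>\<eta>'. ((\<lambda>z. coord d (ystar (chart_inv c z))) has_derivative \<eta>') (at (coord c x)) \<and>
      (\<forall>a b. B (a, \<eta>' a) (0, b) = 0)"
    using B0[OF tangent] by blast
  have cx: "isCont (coord c) x"
    using X.continuous_on_coord[OF c'] continuous_on_eq_continuous_at[OF X.open_chart_dom[OF c']]
      X.charts_atD(2)[OF c] by blast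
  have cy: "isCont (chart_inv d) (\<eta> (coord c x))"
    unfolding \<eta>0
    using Y.continuous_on_chart_inv[OF d'] continuous_on_eq_continuous_at[OF Y.open_chart_image[OF d']]
      Y.coord_in_image[OF d] by blast
  have cont: "isCont (\<lambda>q. chart_inv d (\<eta> (coord c q))) x"
    by (rule isCont_o2[OF isCont_o2[OF cx has_derivative_continuous[OF \<eta>']] cy])
  have "\<forall>\<^sub>F q in nhds x. chart_inv d (\<eta> (coord c q)) = ystar q"
  proof -
    have "open (chart_dom c \<inter> coord c -` N)"
      by (rule continuous_open_preimage[OF X.continuous_on_coord[OF c'] X.open_chart_dom[OF c'] N(1)])
    moreover have "chart_inv d (\<eta> (coord c q)) = ystar q" if "q \<in> chart_dom c \<inter> coord c -` N" for q
      using branch[of "coord c q"] that by (simp add: X.chart_inv_coord[OF c'])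
    ultimately show ?thesis
      unfolding eventually_nhds using X.charts_atD(2)[OF c] N(2) by blast
  qed
  from isCont_cong[OF this] cont show "isCont ystar x"
    by blast
qed

end

lemma hess_y_bij_betw:
  "bij_betw (hess_y My g x (ystar x)) (tangent_space My (ystar x)) (tangent_space My (ystar x))"
proof -
  let ?c = "some_chart Mx x" and ?d = "some_chart My (ystar x)"
  note c = X.some_chart_in[of x] and d = Y.some_chart_in[of "ystar x"]
  have crit: "gradient My (\<lambda>y. g (x, y)) (ystar x) = 0"
    by (simp add: gradient_zero_iff)
  have "a = 0" if "\<And>b. second_derivative ((\<lambda>y. g (x, y)) \<circ> chart_inv ?d) (coord ?d (ystar x)) a b = 0" for a
    using that[of a] second_derivative_y_pos[OF c d, of a] second_derivative_section_y[OF g c d, of a a]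
    by fastforce
  then show ?thesis
    unfolding hess_y_def by (rule Y.hessian_bij_betw[OF d smooth_fun_section[OF g] crit])
qed

lemma
  assumes "w \<in> tangent_space My (ystar x)"
  shows hess_y_inv_in_tangent_space: "hess_y_inv My g x (ystar x) w \<in> tangent_space My (ystar x)"
    and hess_y_hess_y_inv: "hess_y My g x (ystar x) (hess_y_inv My g x (ystar x) w) = w"
proof -
  have "w \<in> hess_y My g x (ystar x) ` tangent_space My (ystar x)"
    using hess_y_bij_betw[of x] assms by (simp add: bij_betw_def)
  then show "hess_y_inv My g x (ystar x) w \<in> tangent_space My (ystar x)"
    and "hess_y My g x (ystar x) (hess_y_inv My g x (ystar x) w) = w"
    unfolding hess_y_inv_def by (rule inv_into_into, rule f_inv_into_f)
qed

lemma rmetric_hess_y: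
  assumes c: "c \<in> charts_at Mx x" and d: "d \<in> charts_at My (ystar x)"
    and v: "v \<in> tangent_space My (ystar x)" and w: "w \<in> tangent_space My (ystar x)"
  shows "rmetric My (ystar x) (hess_y My g x (ystar x) v) w =
    second_derivative (in_charts g c d) (coord c x, coord d (ystar x)) (0, v d) (0, w d)"
  using Y.rmetric_hessian_at_critical_point[OF d smooth_fun_section[OF g] _ v w]
  by (simp add: hess_y_def gradient_zero_iff second_derivative_section_y[OF g c d])

lemma ystar_map_differentiable: "map_differentiable Mx My ystar x"
  unfolding map_differentiable_def
proof (intro conjI ballI)
  show "isCont ystar x"
    by (rule ystar_in_charts(1)[OF X.some_chart_in Y.some_chart_in])
  fix c d
  assume "c \<in> charts_at Mx x" "d \<in> charts_at My (ystar x)"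
  from ystar_in_charts(2)[OF this]
  show "(coord d \<circ> ystar \<circ> chart_inv c) differentiable (at (coord c x))"
    by (auto simp: differentiable_def o_def)
qed

text \<open>Differentiating \<open>\<partial>\<^sub>y g (x, ystar x) = 0\<close> in the direction \<open>u\<close> gives
  \<open>B (u, 0) (0, b) + B (0, D ystar u) (0, b) = 0\<close> for all \<open>b\<close>, where \<open>B\<close> is the second derivative of \<open>g\<close>
  in charts. Through the metric, the first term is the cross derivative and the second the Hessian.\<close>

lemma map_diff_ystar:
  assumes u: "u \<in> tangent_space Mx x"
  shows "map_diff Mx My ystar x u = - hess_y_inv My g x (ystar x) (cross_yx Mx My g x (ystar x) u)"
proof
  fix d
  let ?y = "ystar x"
  note c = X.some_chart_in[of x] and d0 = Y.some_chart_in[of ?y]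
  let ?c = "some_chart Mx x"
  define k where "k = cross_yx Mx My g x ?y u"
  define \<xi> where "\<xi> = hess_y_inv My g x ?y k"
  have k: "k \<in> tangent_space My ?y"
    unfolding k_def by (rule cross_yx_in_tangent_space[OF g c d0 u])
  have \<xi>: "\<xi> \<in> tangent_space My ?y" "hess_y My g x ?y \<xi> = k"
    unfolding \<xi>_def using hess_y_inv_in_tangent_space[OF k] hess_y_hess_y_inv[OF k] by auto
  show "map_diff Mx My ystar x u d = (- hess_y_inv My g x ?y (cross_yx Mx My g x ?y u)) d"
  proof (cases "d \<in> charts_at My ?y")
    case d: True
    let ?B = "second_derivative (in_charts g ?c d) (coord ?c x, coord d ?y)"
    note bil = bilinear_second_derivative_in_charts[OF g c d]
    obtain \<eta>' where \<eta>': "((\<lambda>z. coord d (ystar (chart_inv ?c z))) has_derivative \<eta>') (at (coord ?c x))"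
      and tangent: "\<And>a b. ?B (a, \<eta>' a) (0, b) = 0"
      using ystar_in_charts(2)[OF c d] by blast
    have "?B (0, \<xi> d) (0, b) = ?B (u ?c, 0) (0, b)" for b
    proof -
      let ?w = "tangent_of My ?y d b"
      note w = Y.tangent_of_in[OF d, of b]
      have "?B (0, \<xi> d) (0, ?w d) = ?B (u ?c, 0) (0, ?w d)"
        using rmetric_hess_y[OF c d \<xi>(1) w] rmetric_cross_yx[OF g c d u w] by (simp add: \<xi>(2) k_def)
      then show ?thesis
        by (simp only: Y.tangent_of_self[OF d])
    qed
    then have "?B (0, \<eta>' (u ?c) + \<xi> d) (0, b) = 0" for b
      using tangent[of "u ?c" b] bilinear_ladd[OF bil, of "(u ?c, 0)" "(0, \<eta>' (u ?c))" "(0, b)"]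
        bilinear_ladd[OF bil, of "(0, \<eta>' (u ?c))" "(0, \<xi> d)" "(0, b)"] by simp
    then have "\<eta>' (u ?c) + \<xi> d = 0"
      using second_derivative_y_pos[OF c d, of "\<eta>' (u ?c) + \<xi> d"] by fastforce
    moreover have "map_diff Mx My ystar x u d = \<eta>' (u ?c)"
      using d X.fun_diff_in_chart[OF c u, of "coord d \<circ> ystar" \<eta>'] \<eta>' by (simp add: map_diff_def o_def)
    ultimately show ?thesis
      by (simp add: \<xi>_def k_def eq_neg_iff_add_eq_0)
  next
    case False
    then show ?thesis
      using Y.tangent_space_outside[OF \<xi>(1)] by (simp add: map_diff_def \<xi>_def k_def)
  qed
qed

text \<open>The chain rule gives \<open>D\<^sub>x f u + D\<^sub>y f (D ystar u)\<close>. The second term is the inner product of the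
  \<open>y\<close>-gradient of \<open>f\<close> with \<open>D ystar u\<close>; symmetry of the second derivative of \<open>g\<close>, both in \<open>y\<close> and
  mixed, moves the inverse Hessian and the cross derivative onto that gradient.\<close>

lemma
  assumes f: "smooth_fun (prod_atlas (atlas Mx) (atlas My)) f"
  shows composite_differentiable: "fun_differentiable Mx (\<lambda>x. f (x, ystar x)) x"
    and hypergradient: "gradient Mx (\<lambda>x. f (x, ystar x)) x = grad_x Mx f x (ystar x)
      - cross_xy Mx My g x (ystar x) (hess_y_inv My g x (ystar x) (grad_y My f x (ystar x)))"
proof -
  let ?y = "ystar x" and ?c = "some_chart Mx x" and ?d = "some_chart My (ystar x)"
  note c = X.some_chart_in[of x] and d = Y.some_chart_in[of ?y]
  note c' = X.charts_atD(1)[OF c] and d' = Y.charts_atD(1)[OF d]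
  let ?B = "second_derivative (in_charts g ?c ?d) (coord ?c x, coord ?d ?y)"
  let ?Df = "frechet_derivative (in_charts f ?c ?d) (at (coord ?c x, coord ?d ?y))"
  note bil = bilinear_second_derivative_in_charts[OF g c d]
  obtain \<eta>' where \<eta>': "((\<lambda>z. coord ?d (ystar (chart_inv ?c z))) has_derivative \<eta>') (at (coord ?c x))"
    and tangent: "\<And>a b. ?B (a, \<eta>' a) (0, b) = 0"
    using ystar_in_charts(2)[OF c d] by blast
  have dF: "((\<lambda>x. f (x, ystar x)) \<circ> chart_inv ?c has_derivative (\<lambda>a. ?Df (a, \<eta>' a))) (at (coord ?c x))"
  proof -
    have "((\<lambda>z. (z, coord ?d (ystar (chart_inv ?c z)))) has_derivative (\<lambda>a. (a, \<eta>' a))) (at (coord ?c x))"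
      by (intro has_derivative_Pair has_derivative_ident \<eta>')
    moreover have "(in_charts f ?c ?d has_derivative ?Df)
        (at (coord ?c x, coord ?d (ystar (chart_inv ?c (coord ?c x)))))"
      using smooth_on_imp_has_derivative[OF smooth_on_in_charts[OF f c' d'] in_charts_base[OF f c d]]
      by (simp add: X.chart_inv_coord_at[OF c])
    ultimately have comp: "((\<lambda>z. in_charts f ?c ?d (z, coord ?d (ystar (chart_inv ?c z)))) has_derivative
        (\<lambda>a. ?Df (a, \<eta>' a))) (at (coord ?c x))"
      by (rule has_derivative_compose)
    have "isCont (\<lambda>z. ystar (chart_inv ?c z)) (coord ?c x)"
    proof (rule isCont_o2[where f = "chart_inv ?c" and g = ystar])
      show "isCont (chart_inv ?c) (coord ?c x)"
        using X.continuous_on_chart_inv[OF c'] continuous_on_eq_continuous_at[OF X.open_chart_image[OF c']]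
          X.coord_in_image[OF c] by blast
      show "isCont ystar (chart_inv ?c (coord ?c x))"
        using ystar_in_charts(1)[OF c d] by (simp add: X.chart_inv_coord_at[OF c])
    qed
    then have "((\<lambda>z. ystar (chart_inv ?c z)) \<longlongrightarrow> ystar (chart_inv ?c (coord ?c x))) (nhds (coord ?c x))"
      unfolding isCont_def
      by (rule tendsto_at_iff_tendsto_nhds[where g = "\<lambda>z. ystar (chart_inv ?c z)", THEN iffD1])
    from topological_tendstoD[OF this Y.open_chart_dom[OF d']]
    have "\<forall>\<^sub>F z in nhds (coord ?c x). ystar (chart_inv ?c z) \<in> chart_dom ?d"
      using Y.charts_atD(2)[OF d] by (simp add: X.chart_inv_coord_at[OF c])
    then obtain N where N: "open N" "coord ?c x \<in> N" "\<And>z. z \<in> N \<Longrightarrow> ystar (chart_inv ?c z) \<in> chart_dom ?d"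
      unfolding eventually_nhds by blast
    show ?thesis
      by (rule has_derivative_transform_within_open[OF comp N(1,2)])
        (simp add: in_charts_def Y.chart_inv_coord[OF d' N(3)])
  qed
  then show "fun_differentiable Mx (\<lambda>x. f (x, ystar x)) x"
    using X.fun_differentiableI[OF c] differentiableI by blast
  define k where "k = grad_y My f x ?y"
  define \<xi> where "\<xi> = hess_y_inv My g x ?y k"
  have k: "k \<in> tangent_space My ?y"
    unfolding k_def by (rule grad_y_in_tangent_space[OF f c d])
  have \<xi>: "\<xi> \<in> tangent_space My ?y" "hess_y My g x ?y \<xi> = k"
    unfolding \<xi>_def using hess_y_inv_in_tangent_space[OF k] hess_y_hess_y_inv[OF k] by auto
  have Df_y: "?Df (0, b) = ?B (0, \<xi> ?d) (0, b)" for b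
  proof -
    let ?w = "tangent_of My ?y ?d b"
    note w = Y.tangent_of_in[OF d, of b]
    have "?Df (0, ?w ?d) = ?B (0, \<xi> ?d) (0, ?w ?d)"
      using rmetric_hess_y[OF c d \<xi>(1) w] rmetric_grad_y[OF f c d w] by (simp add: \<xi>(2) k_def)
    then show ?thesis
      by (simp only: Y.tangent_of_self[OF d])
  qed
  have adjoint: "?Df (0, \<eta>' a) = - ?B (0, \<xi> ?d) (a, 0)" for a
  proof -
    have "?B (0, \<xi> ?d) (a, \<eta>' a) = 0"
      using tangent[of a "\<xi> ?d"] second_derivative_in_charts_symmetric[OF g c d] by metis
    then show ?thesis
      using bilinear_radd[OF bil, of "(0, \<xi> ?d)" "(a, 0)" "(0, \<eta>' a)"] by (simp add: Df_y)
  qed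
  have lin: "linear ?Df"
    by (rule has_derivative_linear[OF
          smooth_on_imp_has_derivative[OF smooth_on_in_charts[OF f c' d'] in_charts_base[OF f c d]]])
  note T = grad_x_in_tangent_space[OF f c d] cross_xy_in_tangent_space[OF g c d \<xi>(1)]
  have "gradient Mx (\<lambda>x. f (x, ystar x)) x = grad_x Mx f x ?y - cross_xy Mx My g x ?y \<xi>"
  proof (rule X.gradient_eqI[OF X.tangent_space_diff[OF T]])
    fix u
    assume u: "u \<in> tangent_space Mx x"
    have "rmetric Mx x (grad_x Mx f x ?y - cross_xy Mx My g x ?y \<xi>) u = ?Df (u ?c, 0) - ?B (0, \<xi> ?d) (u ?c, 0)"
      unfolding X.rmetric_diff_left[OF T u] rmetric_grad_x[OF f c d u] rmetric_cross_xy[OF g c d \<xi>(1) u] ..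
    also have "\<dots> = ?Df (u ?c, \<eta>' (u ?c))"
      using linear_add[OF lin, of "(u ?c, 0)" "(0, \<eta>' (u ?c))"] by (simp add: adjoint)
    also have "\<dots> = fun_diff Mx (\<lambda>x. f (x, ystar x)) x u"
      by (rule X.fun_diff_in_chart[OF c u dF, symmetric])
    finally show "rmetric Mx x (grad_x Mx f x ?y - cross_xy Mx My g x ?y \<xi>) u =
      fun_diff Mx (\<lambda>x. f (x, ystar x)) x u" .
  qed
  then show "gradient Mx (\<lambda>x. f (x, ystar x)) x = grad_x Mx f x (ystar x)
      - cross_xy Mx My g x (ystar x) (hess_y_inv My g x (ystar x) (grad_y My f x (ystar x)))"
    by (simp only: \<xi>_def k_def)
qed

end

theorem proposition1:
  fixes Mx :: "('a::{t2_space, second_countable_topology}, 'e::euclidean_space) rmanifold"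
    and My :: "('b::{t2_space, second_countable_topology}, 'f::euclidean_space) rmanifold"
    and f g :: "'a \<times> 'b \<Rightarrow> real"
    and ystar :: "'a \<Rightarrow> 'b"
    and F :: "'a \<Rightarrow> real"
  assumes "riemannian_manifold Mx" and "riemannian_manifold My"
    and "geodesically_convex My"
    and "smooth_fun (prod_atlas (atlas Mx) (atlas My)) f"
    and "smooth_fun (prod_atlas (atlas Mx) (atlas My)) g"
    and "\<And>x. \<exists>\<mu>. geodesic_strongly_convex My \<mu> (\<lambda>y. g (x, y))"
    and "\<And>x y. is_arg_min (\<lambda>y. g (x, y)) (\<lambda>_. True) y \<longleftrightarrow> y = ystar x"
    and "\<And>x. F x = f (x, ystar x)"
  shows "\<forall>x.
    map_differentiable Mx My ystar x \<and>
    bij_betw (hess_y My g x (ystar x))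
      (tangent_space My (ystar x)) (tangent_space My (ystar x)) \<and>
    (\<forall>u\<in>tangent_space Mx x. map_diff Mx My ystar x u =
       - (hess_y_inv My g x (ystar x) \<circ> cross_yx Mx My g x (ystar x)) u) \<and>
    fun_differentiable Mx F x \<and>
    gradient Mx F x =
      grad_x Mx f x (ystar x)
      - cross_xy Mx My g x (ystar x)
          (hess_y_inv My g x (ystar x) (grad_y My f x (ystar x)))"
proof -
  interpret strongly_convex_lower_level Mx My g ystar
    by unfold_locales (use assms in simp_all)
  have F: "F = (\<lambda>x. f (x, ystar x))"
    using assms(8) by (simp add: fun_eq_iff)
  show ?thesis
    unfolding F using ystar_map_differentiable hess_y_bij_betw map_diff_ystar
      composite_differentiable[OF assms(4)] hypergradient[OF assms(4)]
    by (simp add: o_def)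
qed

end
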